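(* The upper bound $l(\gamma)+l(\delta)$ for the length of the orthogonal projection of $l$ onto $m$, where $l$ and $m$ are distinct geodesics in $\mathbb{H}^2$ above closed geodesics $\gamma$ and $\delta$ respectively on an orientable hyperbolic surface, is optimal in the following sense: there are two sequences of closed geodesics $\gamma_n$ and $\delta_n$, and lines $l_n$ and $m_n$ in $\mathbb{H}^2$ above $\gamma_n$ and $\delta_n$ respectively, for which the ratio between the length of the orthogonal projection of $l_n$ onto $m_n$ and the sum $l(\gamma_n)+l(\delta_n)$ approaches $1$.
   Context: The universal cover of a hyperbolic surface is identified isometrically with the hyperbolic plane $\mathbb{H}^2$. For each $n$, the closed geodesics $\gamma_n$ and $\delta_n$ lie on a common orientable hyperbolic surface, and $l_n$ and $m_n$ are distinct. $l(\cdot)$ applied to a closed geodesic denotes its length. A geodesic (line) above a closed geodesic $\gamma$ is one of the complete geodesic lines in $\mathbb{H}^2$ that form the pre-image of $\gamma$. The orthogonal projection of one geodesic line onto another is its image under nearest-point projection; for two lines in $\mathbb{H}^2$ that do not share a point at infinity, the projection of the first onto the second and of the second onto the first have the same finite length. The bound in question is the result that, if $\gamma$ and $\delta$ are closed geodesics on an orientable hyperbolic surface and $l$ and $m$ are distinct geodesics in $\mathbb{H}^2$ above $\gamma$ and $\delta$ respectively, then the orthogonal projection of $l$ onto $m$ has length strictly less than $l(\gamma)+l(\delta)$. *)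

theory Defs
  imports "HOL-Complex_Analysis.Complex_Analysis" "HOL-Algebra.Bij"
begin

section \<open>The hyperbolic plane (upper half-plane model)\<close>

definition hplane :: "complex set" where
  "hplane = {z. Im z > 0}"

text \<open>The distance of the Riemannian metric \<open>|dz|\<^sup>2 / (Im z)\<^sup>2\<close>, which has curvature \<open>-1\<close>.\<close>

definition hdist :: "complex \<Rightarrow> complex \<Rightarrow> real" where
  "hdist z w = arcosh (1 + (cmod (z - w))\<^sup>2 / (2 * Im z * Im w))"

definition unit_speed_geodesic :: "(real \<Rightarrow> complex) \<Rightarrow> bool" where
  "unit_speed_geodesic g \<longleftrightarrow>
     (\<forall>t. g t \<in> hplane) \<and> (\<forall>s t. hdist (g s) (g t) = \<bar>s - t\<bar>)"

definition geodesic_line :: "complex set \<Rightarrow> bool" where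
  "geodesic_line l \<longleftrightarrow> (\<exists>g. unit_speed_geodesic g \<and> l = range g)"

text \<open>Image of \<open>l\<close> under the nearest-point projection onto \<open>m\<close>.\<close>

definition orthogonal_projection :: "complex set \<Rightarrow> complex set \<Rightarrow> complex set" where
  "orthogonal_projection l m = {q \<in> m. \<exists>p \<in> l. \<forall>q' \<in> m. hdist p q \<le> hdist p q'}"

text \<open>The length of a subset of a line is the Lebesgue measure of its parameters under an
  arc-length parametrization. The choice of parametrization is immaterial, since two of them
  differ by \<open>t \<mapsto> \<plusminus>t + a\<close>. A subset of infinite length gets the value 0.\<close>

definition length_in_line :: "complex set \<Rightarrow> complex set \<Rightarrow> real" where
  "length_in_line m X =
     measure lborel ((SOME g. unit_speed_geodesic g \<and> range g = m) -` X)"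

definition projection_length :: "complex set \<Rightarrow> complex set \<Rightarrow> real" where
  "projection_length l m = length_in_line m (orthogonal_projection l m)"


section \<open>Orientable hyperbolic surfaces with universal cover the hyperbolic plane\<close>

text \<open>An isometry of the plane preserves orientation iff it is holomorphic (rather than
  antiholomorphic).\<close>

definition orientation_preserving_isometry :: "(complex \<Rightarrow> complex) \<Rightarrow> bool" where
  "orientation_preserving_isometry f \<longleftrightarrow>
     bij_betw f hplane hplane \<and>
     (\<forall>z \<in> hplane. \<forall>w \<in> hplane. hdist (f z) (f w) = hdist z w) \<and>
     f holomorphic_on hplane"

text \<open>Deck groups: an orientable hyperbolic surface whose universal cover is identified
  isometrically with the hyperbolic plane is the quotient of the plane by a group of
  orientation-preserving isometries acting freely and properly discontinuously.
  Elements of \<^const>\<open>BijGroup\<close> are extensional functions.\<close>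

definition surface_group :: "(complex \<Rightarrow> complex) set \<Rightarrow> bool" where
  "surface_group G \<longleftrightarrow>
     subgroup G (BijGroup hplane) \<and>
     (\<forall>f \<in> G. orientation_preserving_isometry f) \<and>
     (\<forall>f \<in> G. \<forall>z \<in> hplane. f z = z \<longrightarrow> f = (\<lambda>x \<in> hplane. x)) \<and>
     (\<forall>K. compact K \<and> K \<subseteq> hplane \<longrightarrow> finite {f \<in> G. f ` K \<inter> K \<noteq> {}})"

text \<open>Points of the surface are orbits; \<open>covering_map G\<close> is the universal covering.\<close>

definition covering_map :: "(complex \<Rightarrow> complex) set \<Rightarrow> complex \<Rightarrow> complex set" where
  "covering_map G z = (\<lambda>f. f z) ` G"

definition surface :: "(complex \<Rightarrow> complex) set \<Rightarrow> complex set set" where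
  "surface G = covering_map G ` hplane"

definition surface_dist :: "complex set \<Rightarrow> complex set \<Rightarrow> real" where
  "surface_dist P Q = Inf {hdist z w | z w. z \<in> P \<and> w \<in> Q}"

definition closed_geodesic ::
  "(complex \<Rightarrow> complex) set \<Rightarrow> (real \<Rightarrow> complex set) \<Rightarrow> bool" where
  "closed_geodesic G c \<longleftrightarrow>
     (\<forall>t. c t \<in> surface G) \<and>
     (\<forall>t. \<exists>\<epsilon>>0. \<forall>r \<in> ball t \<epsilon>. \<forall>s \<in> ball t \<epsilon>. surface_dist (c r) (c s) = \<bar>r - s\<bar>) \<and>
     (\<exists>T>0. \<forall>t. c (t + T) = c t)"

text \<open>As the parametrization has unit speed, going once around takes time the least positive
  period. A geodesic run through several times is thus not counted as longer.\<close>

definition geodesic_length :: "(real \<Rightarrow> complex set) \<Rightarrow> real" where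
  "geodesic_length c = Inf {T. T > 0 \<and> (\<forall>t. c (t + T) = c t)}"

text \<open>The pre-image of a closed geodesic is a countable union of complete lines. By countability
  these are exactly the geodesic lines contained in the pre-image.\<close>

definition line_above ::
  "(complex \<Rightarrow> complex) set \<Rightarrow> (real \<Rightarrow> complex set) \<Rightarrow> complex set \<Rightarrow> bool" where
  "line_above G c l \<longleftrightarrow> geodesic_line l \<and> l \<subseteq> {z \<in> hplane. covering_map G z \<in> range c}"

end

(* Let s = sqrt 8 and let G be the norm-one units x + y i + z j + w k of the integral quaternion
   order with i^2 = 8, j^2 = 1, acting by the matrices (x + y s, z + w s; z - w s, x - y s). Integrality
   makes G discrete, and reduction mod 8 excludes trace 2 x = 0, so no element is elliptic. The
   imaginary axis covers a fixed closed geodesic, the one of 3 + i. The Pell equation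
   X^2 = 8 Y^2 - 7 has infinitely many solutions, and X - Y i - k is then a hyperbolic element with
   fixed points -v and -1/v, where v = Y + sqrt (Y^2 - 1). Its axis projects to an interval of
   length 2 ln v of the imaginary axis. An element of G translating by T along this axis has integral
   k-coefficient w with |w| s (v - 1/v) = 2 sinh (T/2), so the unit with w = -1 has the
   shortest translation, and the closed geodesic has length 2 ln v + O(1). The imaginary axis
   contributes only a constant to the sum of the two lengths, hence the ratio tends to 1. *)

theory Submission
  imports Defs "HOL-Real_Asymp.Real_Asymp"
begin

section \<open>Moebius transformations and the hyperbolic distance\<close>

definition mob :: "real \<Rightarrow> real \<Rightarrow> real \<Rightarrow> real \<Rightarrow> complex \<Rightarrow> complex" where
  "mob a b c d z = (of_real a * z + of_real b) / (of_real c * z + of_real d)"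

lemma mob_denominator_nonzero:
  assumes "a * d - b * c > 0" "z \<in> hplane"
  shows "of_real c * z + of_real d \<noteq> 0"
  using assms by (auto simp: complex_eq_iff hplane_def)

lemma Im_mob:
  "Im (mob a b c d z) = (a * d - b * c) * Im z / (cmod (of_real c * z + of_real d))\<^sup>2"
  by (simp add: mob_def Im_divide cmod_power2 algebra_simps)

lemma mob_in_hplane:
  assumes "a * d - b * c > 0" "z \<in> hplane"
  shows "mob a b c d z \<in> hplane"
  using assms mob_denominator_nonzero[OF assms] by (simp add: hplane_def Im_mob)

lemma mob_mob:
  assumes "a' * d' - b' * c' > 0" "z \<in> hplane"
  shows "mob a b c d (mob a' b' c' d' z) =
    mob (a * a' + b * c') (a * b' + b * d') (c * a' + d * c') (c * b' + d * d') z"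
proof -
  define w where "w = of_real c' * z + of_real d'"
  have w: "w \<noteq> 0"
    unfolding w_def using mob_denominator_nonzero[OF assms] .
  have "mob a b c d (u / w) = (of_real a * u + of_real b * w) / (of_real c * u + of_real d * w)" for u
  proof -
    have "mob a b c d (u / w) = (w * (of_real a * (u / w) + of_real b)) / (w * (of_real c * (u / w) + of_real d))"
      using w by (simp add: mob_def)
    also have "w * (of_real a * (u / w) + of_real b) = of_real a * u + of_real b * w"
      using w by (simp add: field_simps)
    also have "w * (of_real c * (u / w) + of_real d) = of_real c * u + of_real d * w"
      using w by (simp add: field_simps)
    finally show ?thesis .
  qed
  from this[of "of_real a' * z + of_real b'"] show ?thesis
    by (simp add: mob_def w_def algebra_simps)
qed

lemma mob_diff:
  assumes "a * d - b * c > 0" "z \<in> hplane" "w \<in> hplane"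
  shows "mob a b c d z - mob a b c d w = of_real (a * d - b * c) * (z - w) /
    ((of_real c * z + of_real d) * (of_real c * w + of_real d))"
  using mob_denominator_nonzero[OF assms(1,2)] mob_denominator_nonzero[OF assms(1,3)]
  by (simp add: mob_def diff_frac_eq) (simp add: algebra_simps)

text \<open>The squared distance of the images acquires the factor
  \<open>D\<^sup>2 / (u * v)\<^sup>2\<close>, and so does the product of their imaginary parts, so
  the quotient inside \<open>arcosh\<close> is unchanged.\<close>

lemma hdist_mob:
  assumes det: "a * d - b * c > 0" and z: "z \<in> hplane" and w: "w \<in> hplane"
  shows "hdist (mob a b c d z) (mob a b c d w) = hdist z w"
proof -
  define D where "D = a * d - b * c"
  define u where "u = cmod (of_real c * z + of_real d)"
  define v where "v = cmod (of_real c * w + of_real d)"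
  have pos: "D > 0" "u > 0" "v > 0" "Im z > 0" "Im w > 0"
    using assms mob_denominator_nonzero[OF det z] mob_denominator_nonzero[OF det w]
    by (auto simp: D_def u_def v_def hplane_def)
  have "cmod (mob a b c d z - mob a b c d w) = D * cmod (z - w) / (u * v)"
    using pos(1) unfolding mob_diff[OF det z w] D_def[symmetric]
    by (simp add: norm_mult norm_divide u_def v_def)
  moreover have "Im (mob a b c d z) = D * Im z / u\<^sup>2" "Im (mob a b c d w) = D * Im w / v\<^sup>2"
    by (simp_all add: Im_mob D_def u_def v_def)
  moreover have "(D * x / (u * v))\<^sup>2 / (2 * (D * Im z / u\<^sup>2) * (D * Im w / v\<^sup>2))
    = x\<^sup>2 / (2 * Im z * Im w)" for x
    using pos by (simp add: field_simps power2_eq_square)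
  ultimately show ?thesis
    by (simp add: hdist_def)
qed

lemma mob_inverse:
  assumes "a * d - b * c = 1" "z \<in> hplane"
  shows "mob d (- b) (- c) a (mob a b c d z) = z"
  using assms by (subst mob_mob) (auto simp: mob_def algebra_simps simp flip: of_real_mult of_real_diff of_real_add)

lemma bij_betw_mob:
  assumes "a * d - b * c = 1"
  shows "bij_betw (mob a b c d) hplane hplane"
proof (rule bij_betw_byWitness[where f' = "mob d (- b) (- c) a"])
  show "\<forall>z\<in>hplane. mob d (- b) (- c) a (mob a b c d z) = z"
    using mob_inverse assms by blast
  show "\<forall>z\<in>hplane. mob a b c d (mob d (- b) (- c) a z) = z"
    using mob_inverse[of d a "- b" "- c"] assms by (simp add: algebra_simps)
  show "mob a b c d ` hplane \<subseteq> hplane" "mob d (- b) (- c) a ` hplane \<subseteq> hplane"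
    using assms by (auto intro!: mob_in_hplane simp: algebra_simps)
qed

lemma holomorphic_on_mob:
  assumes "a * d - b * c > 0"
  shows "mob a b c d holomorphic_on hplane"
  unfolding mob_def using mob_denominator_nonzero[OF assms] by (intro holomorphic_intros) auto

lemma orientation_preserving_isometry_mob:
  assumes "a * d - b * c = 1"
  shows "orientation_preserving_isometry (restrict (mob a b c d) hplane)"
proof -
  have "restrict (mob a b c d) hplane holomorphic_on hplane"
    by (rule holomorphic_transform[OF holomorphic_on_mob]) (use assms in auto)
  then show ?thesis
    using assms bij_betw_mob[OF assms]
    by (simp add: orientation_preserving_isometry_def hdist_mob bij_betw_restrict_eq)
qed

text \<open>A fixed point of height \<open>y\<close> turns the discriminant
  \<open>(a + d)\<^sup>2 - 4\<close> into \<open>- 4 * (c * y)\<^sup>2\<close>. If the trace has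
  absolute value at least 2, this forces \<open>c = 0\<close>. This is how elliptic elements are
  excluded.\<close>

lemma mob_fixed_point:
  assumes det: "a * d - b * c = 1" and z: "z \<in> hplane" and fixed: "mob a b c d z = z"
    and tr: "(a + d)\<^sup>2 \<ge> 4"
  shows "b = 0 \<and> c = 0 \<and> d = a"
proof -
  have nz: "of_real c * z + of_real d \<noteq> 0"
    using mob_denominator_nonzero[where a = a and b = b and c = c and d = d and z = z] det z by simp
  define x y where "x = Re z" and "y = Im z"
  have y: "y > 0" using z by (simp add: y_def hplane_def)
  have "of_real a * z + of_real b = z * (of_real c * z + of_real d)"
    using fixed nz by (simp add: mob_def field_simps)
  then have re: "a * x + b = c * (x\<^sup>2 - y\<^sup>2) + d * x" and im: "a * y = 2 * c * x * y + d * y"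
    by (auto simp: complex_eq_iff x_def y_def algebra_simps power2_eq_square)
  from im y have ad: "a - d = 2 * c * x"
    by (metis add.commute add_diff_cancel_left' distrib_right mult_cancel_right
        less_irrefl diff_eq_eq)
  have b: "b = - c * (x\<^sup>2 + y\<^sup>2)"
    using re ad by algebra
  have "(a + d)\<^sup>2 - 4 = (a - d)\<^sup>2 + 4 * (b * c)"
    using det by algebra
  also have "\<dots> = - 4 * (c * y)\<^sup>2"
    unfolding ad b by algebra
  finally have "(c * y)\<^sup>2 \<le> 0"
    using tr by linarith
  then have "c = 0" using y by simp
  with ad b show ?thesis by simp
qed

text \<open>Quantitative discreteness: a matrix of determinant 1 that moves some point of a compact
  region back into the region has entries bounded in terms of \<open>R\<close> and \<open>r\<close>.
  Together with integrality of the entries this yields proper discontinuity.\<close>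

lemma mob_preimage_bound:
  assumes det: "a * d - b * c = 1" and r: "r > 0" and R: "R > 0"
    and z: "cmod z \<le> R" "Im z \<ge> r" and w: "cmod (mob a b c d z) \<le> R" "Im (mob a b c d z) \<ge> r"
  defines "q \<equiv> R / r"
  shows "\<bar>a\<bar> \<le> (1 + q) * q" "\<bar>b\<bar> \<le> R * (1 + q) + R * (1 + q) * q"
    "\<bar>c\<bar> \<le> (1 + q) / r" "\<bar>d\<bar> \<le> (1 + q) + (1 + q) * q"
proof -
  have zh: "z \<in> hplane" using z r by (simp add: hplane_def)
  \<comment> \<open>The imaginary part of the affine form is \<open>u * Im z\<close> with
    \<open>Im z \<ge> r\<close>, which bounds \<open>u\<close>; subtracting \<open>u * z\<close>
    then bounds \<open>v\<close>. It is applied to the denominator and to the numerator of the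
    transformation.\<close>
  have affine_bound: "\<bar>u\<bar> \<le> S / r \<and> \<bar>v\<bar> \<le> S + S / r * R"
    if S: "cmod (of_real u * z + of_real v) \<le> S" for u v S
  proof
    have "\<bar>u\<bar> * r \<le> \<bar>u\<bar> * \<bar>Im z\<bar>"
      using z r by (intro mult_left_mono) auto
    also have "\<dots> \<le> S"
      using abs_Im_le_cmod[of "of_real u * z + of_real v"] S by (simp add: abs_mult)
    finally show u: "\<bar>u\<bar> \<le> S / r"
      using r by (simp add: field_simps)
    have "\<bar>v\<bar> = cmod ((of_real u * z + of_real v) - of_real u * z)"
      by simp
    also have "\<dots> \<le> S + \<bar>u\<bar> * cmod z"
      using norm_triangle_ineq4[of "of_real u * z + of_real v" "of_real u * z"] S
      by (simp add: norm_mult)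
    also have "\<bar>u\<bar> * cmod z \<le> S / r * R"
      using u z by (intro mult_mono) (auto intro: order_trans[OF abs_ge_zero])
    finally show "\<bar>v\<bar> \<le> S + S / r * R"
      by simp
  qed
  define \<beta> where "\<beta> = cmod (of_real c * z + of_real d)"
  have \<beta>0: "\<beta> > 0"
    using mob_denominator_nonzero[where a = a and b = b and c = c and d = d and z = z] det zh by (simp add: \<beta>_def)
  \<comment> \<open>The height of the image is \<open>Im z / \<beta>\<^sup>2\<close>, so a large
    denominator would push the image below height \<open>r\<close>.\<close>
  have "r \<le> Im z / \<beta>\<^sup>2"
    using w(2) det by (simp add: Im_mob \<beta>_def)
  then have "\<beta>\<^sup>2 * r \<le> Im z"
    using \<beta>0 by (simp add: field_simps)
  also have "Im z \<le> R"
    using abs_Im_le_cmod[of z] z by linarith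
  finally have "\<beta>\<^sup>2 \<le> q"
    using r by (simp add: q_def field_simps)
  \<comment> \<open>The cruder bound \<open>1 + q\<close> for \<open>\<beta>\<close> avoids a square
    root.\<close>
  also have "q \<le> (1 + q)\<^sup>2"
    using divide_pos_pos[OF R r, folded q_def] by (simp add: power2_eq_square algebra_simps)
  also have "1 + q = 1 + R / r"
    by (simp add: q_def)
  finally have \<beta>: "\<beta> \<le> 1 + R / r"
    using r R by (meson power2_le_imp_le add_nonneg_nonneg divide_nonneg_pos less_imp_le zero_le_one)
  have "cmod (of_real a * z + of_real b) = cmod (mob a b c d z) * \<beta>"
    using \<beta>0 by (simp add: mob_def \<beta>_def norm_divide)
  also have "\<dots> \<le> R * (1 + R / r)"
    using w \<beta> \<beta>0 R by (intro mult_mono) auto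
  finally have ab: "cmod (of_real a * z + of_real b) \<le> R * (1 + R / r)" .
  show "\<bar>c\<bar> \<le> (1 + q) / r" "\<bar>d\<bar> \<le> (1 + q) + (1 + q) * q"
    using affine_bound[of c d "1 + q"] \<beta> by (auto simp: \<beta>_def q_def)
  show "\<bar>a\<bar> \<le> (1 + q) * q" "\<bar>b\<bar> \<le> R * (1 + q) + R * (1 + q) * q"
    using affine_bound[OF ab] r by (auto simp: q_def field_simps)
qed

section \<open>Comparison, lower bounds and continuity of the hyperbolic distance\<close>

lemma hdist_argument_ge_1:
  assumes "z \<in> hplane" "w \<in> hplane"
  shows "1 \<le> 1 + (cmod (z - w))\<^sup>2 / (2 * Im z * Im w)"
  using assms by (simp add: hplane_def)

text \<open>By monotonicity of \<open>arcosh\<close> and cancellation of \<open>2 * Im z\<close>,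
  the search for nearest points becomes the minimization of an algebraic expression.\<close>

lemma hdist_le_iff:
  assumes "z \<in> hplane" "w \<in> hplane" "w' \<in> hplane"
  shows "hdist z w \<le> hdist z w' \<longleftrightarrow> (cmod (z - w))\<^sup>2 / Im w \<le> (cmod (z - w'))\<^sup>2 / Im w'"
proof -
  have pos: "Im z > 0" "Im w > 0" "Im w' > 0"
    using assms by (auto simp: hplane_def)
  have "hdist z w \<le> hdist z w' \<longleftrightarrow>
    (cmod (z - w))\<^sup>2 / (2 * Im z * Im w) \<le> (cmod (z - w'))\<^sup>2 / (2 * Im z * Im w')"
    using arcosh_less_iff_real[OF hdist_argument_ge_1[OF assms(1,3)] hdist_argument_ge_1[OF assms(1,2)]]
    by (auto simp: hdist_def not_less[symmetric])
  also have "\<dots> \<longleftrightarrow> (cmod (z - w))\<^sup>2 / Im w \<le> (cmod (z - w'))\<^sup>2 / Im w'"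
    using pos by (simp add: field_simps)
  finally show ?thesis .
qed

lemma hdist_pos:
  assumes "z \<in> hplane" "w \<in> hplane" "z \<noteq> w"
  shows "hdist z w > 0"
  unfolding hdist_def
  using assms by (subst arcosh_real_gt_1_iff[OF hdist_argument_ge_1]) (auto simp: hplane_def)

text \<open>Euclidean separation gives hyperbolic separation uniformly in \<open>w\<close>, although
  \<open>w\<close> may lie arbitrarily high: \<open>Im w \<le> Y + u\<close> for the Euclidean
  distance \<open>u\<close>, and \<open>u\<^sup>2 / (Y + u)\<close> increases with
  \<open>u\<close>.\<close>

lemma hdist_lower_bound:
  assumes z: "z \<in> hplane" and w: "w \<in> hplane" and Y: "Im z \<le> Y" and \<delta>: "\<delta> > 0" "\<delta> \<le> cmod (z - w)"
  shows "arcosh (1 + \<delta>\<^sup>2 / (2 * Y * (Y + \<delta>))) \<le> hdist z w"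
proof -
  define u where "u = cmod (z - w)"
  have pos: "Im z > 0" "Im w > 0" "u \<ge> \<delta>" "Y > 0" "u > 0"
    using z w \<delta> Y by (auto simp: hplane_def u_def)
  have Im_w: "Im w \<le> Y + u"
    using abs_Im_le_cmod[of "z - w"] Y by (simp add: u_def)
  have "\<delta>\<^sup>2 * (Y + u) \<le> u\<^sup>2 * (Y + \<delta>)"
  proof -
    have "\<delta>\<^sup>2 * Y \<le> u\<^sup>2 * Y"
      using pos \<delta> by (intro mult_right_mono power_mono) auto
    moreover have "\<delta> * u * \<delta> \<le> \<delta> * u * u"
      using pos \<delta> by (intro mult_left_mono) auto
    ultimately show ?thesis by (simp add: algebra_simps power2_eq_square)
  qed
  then have "\<delta>\<^sup>2 / (Y + \<delta>) \<le> u\<^sup>2 / (Y + u)"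
    using pos \<delta> by (simp add: field_simps)
  then have "\<delta>\<^sup>2 / (Y + \<delta>) / (2 * Y) \<le> u\<^sup>2 / (Y + u) / (2 * Y)"
    using pos by (intro divide_right_mono) auto
  then have "\<delta>\<^sup>2 / (2 * Y * (Y + \<delta>)) \<le> u\<^sup>2 / (2 * Y * (Y + u))"
    by (simp add: mult.commute)
  also have "\<dots> \<le> u\<^sup>2 / (2 * Im z * Im w)"
    using pos Y Im_w by (intro divide_left_mono mult_mono mult_pos_pos) auto
  finally have le: "1 + \<delta>\<^sup>2 / (2 * Y * (Y + \<delta>)) \<le> 1 + u\<^sup>2 / (2 * Im z * Im w)"
    by simp
  have "1 \<le> 1 + \<delta>\<^sup>2 / (2 * Y * (Y + \<delta>))"
    using pos \<delta> by simp
  with le show ?thesis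
    using arcosh_less_iff_real[of "1 + u\<^sup>2 / (2 * Im z * Im w)" "1 + \<delta>\<^sup>2 / (2 * Y * (Y + \<delta>))"]
    unfolding hdist_def u_def[symmetric] by linarith
qed

lemma continuous_on_hdist:
  assumes "continuous_on S f" "continuous_on S g" "f ` S \<subseteq> hplane" "g ` S \<subseteq> hplane"
  shows "continuous_on S (\<lambda>x. hdist (f x) (g x))"
proof -
  have pos: "0 < Im (f x)" "0 < Im (g x)" if "x \<in> S" for x
    using that assms(3,4) by (auto simp: hplane_def)
  show ?thesis
    unfolding hdist_def
  proof (rule continuous_on_compose2[OF continuous_on_arcosh[of "{1..}"]])
    show "continuous_on S (\<lambda>x. 1 + (cmod (f x - g x))\<^sup>2 / (2 * Im (f x) * Im (g x)))"
      using pos by (intro continuous_intros assms(1,2)) force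
  qed (use pos in \<open>auto simp: less_imp_le\<close>)
qed

section \<open>Closed geodesics on quotient surfaces\<close>

lemma surface_group_one: "surface_group G \<Longrightarrow> (\<lambda>z\<in>hplane. z) \<in> G"
  using subgroup.one_closed[of G "BijGroup hplane"] by (simp add: surface_group_def BijGroup_def)

lemma surface_group_maps:
  "surface_group G \<Longrightarrow> f \<in> G \<Longrightarrow> z \<in> hplane \<Longrightarrow> f z \<in> hplane"
  unfolding surface_group_def orientation_preserving_isometry_def by (meson bij_betwE)

lemma surface_group_compose:
  assumes "surface_group G" "f \<in> G" "h \<in> G"
  shows "compose hplane f h \<in> G"
proof -
  have sub: "subgroup G (BijGroup hplane)" using assms by (simp add: surface_group_def)
  have "f \<in> Bij hplane" "h \<in> Bij hplane"
    using subgroup.subset[OF sub] assms by (auto simp: BijGroup_def)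
  then show ?thesis
    using subgroup.m_closed[OF sub assms(2,3)] by (simp add: BijGroup_def)
qed

lemma surface_group_inverse:
  assumes "surface_group G" "f \<in> G"
  shows "\<exists>h\<in>G. \<forall>z\<in>hplane. h (f z) = z"
proof -
  have sub: "subgroup G (BijGroup hplane)" using assms by (simp add: surface_group_def)
  define h where "h = inv\<^bsub>BijGroup hplane\<^esub> f"
  have h: "h \<in> G" unfolding h_def using subgroup.m_inv_closed[OF sub assms(2)] .
  have Bij: "f \<in> Bij hplane" "h \<in> Bij hplane"
    using subgroup.subset[OF sub] assms h by (auto simp: BijGroup_def)
  have "h \<otimes>\<^bsub>BijGroup hplane\<^esub> f = \<one>\<^bsub>BijGroup hplane\<^esub>"
    unfolding h_def using Bij by (intro group.l_inv[OF group_BijGroup]) (simp add: BijGroup_def)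
  then have "compose hplane h f = (\<lambda>z\<in>hplane. z)"
    using Bij by (simp add: BijGroup_def)
  then have "h (f z) = z" if "z \<in> hplane" for z
    using that by (metis compose_eq restrict_apply')
  with h show ?thesis by blast
qed

lemma covering_map_eq_iff:
  assumes G: "surface_group G" and z: "z \<in> hplane" and w: "w \<in> hplane"
  shows "covering_map G z = covering_map G w \<longleftrightarrow> (\<exists>f\<in>G. f z = w)"
proof
  assume "covering_map G z = covering_map G w"
  moreover have "w \<in> covering_map G w"
    using surface_group_one[OF G] w unfolding covering_map_def by (intro image_eqI) auto
  ultimately have "w \<in> (\<lambda>f. f z) ` G"
    by (simp add: covering_map_def)
  then show "\<exists>f\<in>G. f z = w" by blast
next
  have sub: "covering_map G (f x) \<subseteq> covering_map G x" if "f \<in> G" "x \<in> hplane" for f x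
  proof
    fix y assume "y \<in> covering_map G (f x)"
    then obtain k where "k \<in> G" "y = k (f x)"
      unfolding covering_map_def by auto
    then show "y \<in> covering_map G x"
      using surface_group_compose[OF G _ that(1), of k] that(2) unfolding covering_map_def
      by (intro image_eqI[of _ _ "compose hplane k f"]) (auto simp: compose_eq)
  qed
  assume "\<exists>f\<in>G. f z = w"
  then obtain f where f: "f \<in> G" "f z = w" by blast
  obtain h where "h \<in> G" "h w = z"
    using surface_group_inverse[OF G f(1)] f(2) z by blast
  with sub[OF f(1) z] sub[of h w] f w show "covering_map G z = covering_map G w"
    by auto
qed

text \<open>Only finitely many elements move the compact disc \<open>K\<close> so that it meets
  itself. Each nontrivial one displaces \<open>p\<close> by freeness, and by continuity also the
  points near \<open>p\<close>. All other elements carry \<open>K\<close> off itself, hence carry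
  points of \<open>U\<close> a definite distance away. This makes the covering a local
  isometry.\<close>

lemma surface_group_displacement:
  assumes G: "surface_group G" and p: "p \<in> hplane"
  obtains U \<eta> where "open U" "p \<in> U" "U \<subseteq> hplane" "\<eta> > 0"
    "\<And>f z w. f \<in> G \<Longrightarrow> f \<noteq> (\<lambda>x\<in>hplane. x) \<Longrightarrow> z \<in> U \<Longrightarrow> w \<in> U \<Longrightarrow> \<eta> \<le> hdist z (f w)"
proof -
  define \<rho> where "\<rho> = Im p / 2"
  have \<rho>: "\<rho> > 0" using p by (simp add: \<rho>_def hplane_def)
  define K where "K = cball p \<rho>"
  have Im_K: "\<rho> \<le> Im z \<and> Im z \<le> 3 * \<rho>" if "z \<in> K" for z
    using that abs_Im_le_cmod[of "p - z"] by (auto simp: K_def dist_norm \<rho>_def)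
  have K: "compact K" "K \<subseteq> hplane"
    using Im_K \<rho> by (force simp: K_def hplane_def)+
  define S where "S = {f \<in> G. f ` K \<inter> K \<noteq> {}} - {\<lambda>x\<in>hplane. x}"
  have S: "finite S"
    using G K by (simp add: S_def surface_group_def)
  have open_hplane: "open hplane"
    unfolding hplane_def by (rule open_halfspace_Im_gt)
  have near: "\<exists>V \<epsilon>. open V \<and> p \<in> V \<and> V \<subseteq> hplane \<and> \<epsilon> > 0 \<and> (\<forall>z\<in>V. \<forall>w\<in>V. \<epsilon> \<le> hdist z (f w))"
    if f: "f \<in> S" for f
  proof -
    have fG: "f \<in> G" and "f \<noteq> (\<lambda>x\<in>hplane. x)"
      using f by (auto simp: S_def)
    then have "f p \<noteq> p"
      using G p by (auto simp: surface_group_def)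
    then have pos: "hdist p (f p) > 0"
      using hdist_pos[OF p surface_group_maps[OF G fG p]] by simp
    have "f holomorphic_on hplane"
      using G fG by (simp add: surface_group_def orientation_preserving_isometry_def)
    then have cf: "continuous_on hplane f"
      by (rule holomorphic_on_imp_continuous_on)
    \<comment> \<open>At \<open>(p, p)\<close> the displacement is positive; by joint continuity
      half of it persists on a product neighbourhood.\<close>
    have "continuous_on (hplane \<times> hplane) (\<lambda>x. hdist (fst x) (f (snd x)))"
      using surface_group_maps[OF G fG]
      by (intro continuous_on_hdist continuous_intros continuous_on_compose2[OF cf]) auto
    then have "open (hplane \<times> hplane \<inter> (\<lambda>x. hdist (fst x) (f (snd x))) -` {hdist p (f p) / 2<..})"
      (is "open ?W")
      by (rule continuous_open_preimage[OF _ open_Times[OF open_hplane open_hplane] open_greaterThan])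
    moreover have "(p, p) \<in> ?W" using p pos by simp
    ultimately obtain A B where AB: "open A" "open B" "p \<in> A" "p \<in> B" "A \<times> B \<subseteq> ?W"
      by (auto elim!: open_prod_elim)
    have "hdist p (f p) / 2 \<le> hdist z (f w)" if "z \<in> A" "w \<in> B" for z w
      using AB(5) that by (auto intro: less_imp_le)
    with AB pos p open_hplane show ?thesis
      by (intro exI[of _ "A \<inter> B \<inter> hplane"] exI[of _ "hdist p (f p) / 2"]) auto
  qed
  then obtain V \<epsilon> where V: "\<And>f. f \<in> S \<Longrightarrow> open (V f) \<and> p \<in> V f \<and> V f \<subseteq> hplane \<and> \<epsilon> f > 0 \<and>
      (\<forall>z\<in>V f. \<forall>w\<in>V f. \<epsilon> f \<le> hdist z (f w))"
    by metis
  \<comment> \<open>This is the value of \<open>hdist_lower_bound\<close> for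
    \<open>Y = 3 * \<rho>\<close>, the greatest height in \<open>K\<close>, and Euclidean separation
    \<open>\<rho> / 2\<close>.\<close>
  define \<kappa> where "\<kappa> = arcosh (1 + (\<rho> / 2)\<^sup>2 / (2 * (3 * \<rho>) * (3 * \<rho> + \<rho> / 2)))"
  have \<kappa>: "\<kappa> > 0"
    unfolding \<kappa>_def using \<rho> by (subst arcosh_real_gt_1_iff) auto
  define U where "U = ball p (\<rho> / 2) \<inter> (\<Inter>f\<in>S. V f)"
  define \<eta> where "\<eta> = Min (insert \<kappa> (\<epsilon> ` S))"
  have UK: "U \<subseteq> K"
  proof
    fix z assume "z \<in> U"
    then have "dist p z < \<rho> / 2" by (simp add: U_def)
    then show "z \<in> K" using \<rho> by (simp add: K_def)
  qed
  show thesis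
  proof (rule that)
    show "open U" unfolding U_def using S V by (intro open_Int open_INT) auto
    show "p \<in> U" unfolding U_def using V \<rho> by auto
    show "U \<subseteq> hplane" using UK K by blast
    show "\<eta> > 0" unfolding \<eta>_def using S V \<kappa> by auto
    fix f z w assume f: "f \<in> G" "f \<noteq> (\<lambda>x\<in>hplane. x)" and z: "z \<in> U" and w: "w \<in> U"
    show "\<eta> \<le> hdist z (f w)"
    proof (cases "f \<in> S")
      case True
      then have "\<epsilon> f \<le> hdist z (f w)" using V z w by (auto simp: U_def)
      moreover have "\<eta> \<le> \<epsilon> f" unfolding \<eta>_def using S True by simp
      ultimately show ?thesis by linarith
    next
      case False
      have wK: "w \<in> K" and zK: "z \<in> K" using w z UK by auto
      then have "f w \<notin> K" using False f by (auto simp: S_def)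
      then have "\<rho> < dist p (f w)" by (simp add: K_def)
      moreover have "dist p z < \<rho> / 2" using z by (simp add: U_def)
      ultimately have far: "\<rho> / 2 \<le> cmod (z - f w)"
        using dist_triangle[of p "f w" z] by (simp add: dist_norm)
      have "\<kappa> \<le> hdist z (f w)"
        unfolding \<kappa>_def using zK wK K Im_K \<rho> far surface_group_maps[OF G f(1)]
        by (intro hdist_lower_bound) auto
      moreover have "\<eta> \<le> \<kappa>" unfolding \<eta>_def using S by simp
      ultimately show ?thesis by linarith
    qed
  qed
qed

text \<open>Distances on the surface are infima over pairs of orbit points. Near a given parameter
  every nontrivial element displaces by at least \<open>\<eta>\<close>, so the infimum for two
  parameters closer than \<open>\<eta>\<close> is attained by the points of \<open>g\<close>
  themselves. The translation \<open>f\<close> supplies the period.\<close>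

lemma closed_geodesic_covering_map:
  assumes G: "surface_group G" and g: "unit_speed_geodesic g" "continuous_on UNIV g"
    and T: "T > 0" "f \<in> G" "\<And>t. f (g t) = g (t + T)"
  shows "closed_geodesic G (covering_map G \<circ> g)"
proof -
  have gh: "g t \<in> hplane" and gd: "hdist (g s) (g t) = \<bar>s - t\<bar>" for s t
    using g by (auto simp: unit_speed_geodesic_def)
  have "\<exists>\<epsilon>>0. \<forall>r\<in>ball t \<epsilon>. \<forall>s\<in>ball t \<epsilon>.
    surface_dist (covering_map G (g r)) (covering_map G (g s)) = \<bar>r - s\<bar>" for t
  proof -
    obtain U \<eta> where U: "open U" "g t \<in> U" "U \<subseteq> hplane" "\<eta> > 0"
      "\<And>f z w. f \<in> G \<Longrightarrow> f \<noteq> (\<lambda>x\<in>hplane. x) \<Longrightarrow> z \<in> U \<Longrightarrow> w \<in> U \<Longrightarrow> \<eta> \<le> hdist z (f w)"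
      using surface_group_displacement[OF G gh[of t]] by blast
    have "open (g -` U)"
      using g(2) U(1) by (simp add: open_vimage)
    then obtain \<epsilon> where \<epsilon>: "\<epsilon> > 0" "ball t \<epsilon> \<subseteq> g -` U"
      using U(2) unfolding open_contains_ball by blast
    \<comment> \<open>Two parameters in a ball of radius \<open>\<eta> / 2\<close> differ by less
      than \<open>\<eta>\<close>.\<close>
    define e where "e = min \<epsilon> (\<eta> / 2)"
    have "surface_dist (covering_map G (g r)) (covering_map G (g s)) = \<bar>r - s\<bar>"
      if r: "r \<in> ball t e" and s: "s \<in> ball t e" for r s
      unfolding surface_dist_def
    proof (rule cInf_eq_minimum)
      have "g r \<in> covering_map G (g r)" for r
        using surface_group_one[OF G] gh unfolding covering_map_def by (intro image_eqI) auto
      then show "\<bar>r - s\<bar> \<in> {hdist z w |z w. z \<in> covering_map G (g r) \<and> w \<in> covering_map G (g s)}"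
        using gd[of r s] by force
    next
      fix x assume "x \<in> {hdist z w |z w. z \<in> covering_map G (g r) \<and> w \<in> covering_map G (g s)}"
      then obtain f h where f: "f \<in> G" and h: "h \<in> G" and x: "x = hdist (f (g r)) (h (g s))"
        unfolding covering_map_def by auto
      obtain k where k: "k \<in> G" "\<And>z. z \<in> hplane \<Longrightarrow> k (f z) = z"
        using surface_group_inverse[OF G f] by blast
      \<comment> \<open>Applying the inverse of \<open>f\<close> to both orbit points leaves
        \<open>g r\<close> fixed and collects the two deck transformations in the single element
        \<open>j\<close>.\<close>
      define j where "j = compose hplane k h"
      have j: "j \<in> G" unfolding j_def using surface_group_compose[OF G k(1) h] .
      have "hdist (k (f (g r))) (k (h (g s))) = hdist (f (g r)) (h (g s))"
        using G k(1) surface_group_maps[OF G f gh] surface_group_maps[OF G h gh]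
        by (simp add: surface_group_def orientation_preserving_isometry_def)
      then have x': "x = hdist (g r) (j (g s))"
        using x k(2) gh by (simp add: j_def compose_eq)
      show "\<bar>r - s\<bar> \<le> x"
      proof (cases "j = (\<lambda>x\<in>hplane. x)")
        case True
        then show ?thesis using x' gd gh by simp
      next
        case False
        have "g r \<in> U" "g s \<in> U"
          using r s \<epsilon> by (auto simp: e_def)
        then have "\<eta> \<le> x"
          unfolding x' using U(5)[OF j False] by simp
        moreover have "\<bar>r - s\<bar> < \<eta>"
          using r s unfolding e_def mem_ball dist_real_def by linarith
        ultimately show ?thesis by linarith
      qed
    qed
    moreover have "e > 0" using \<epsilon> U by (simp add: e_def)
    ultimately show ?thesis by blast
  qed
  moreover have "covering_map G (g (t + T)) = covering_map G (g t)" for t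
    using covering_map_eq_iff[OF G gh gh] T by metis
  ultimately show ?thesis
    unfolding closed_geodesic_def using T(1) gh by (auto simp: surface_def)
qed

text \<open>A period only gives, for each parameter separately, some deck transformation. Proper
  discontinuity leaves finitely many candidates for the parameters in \<open>{0..1}\<close>, so by
  the pigeonhole principle one element serves two different parameters.\<close>

lemma surface_group_translation:
  assumes G: "surface_group G" and g: "continuous_on UNIV g" "range g \<subseteq> hplane"
    and period: "\<And>t::real. covering_map G (g (t + T)) = covering_map G (g t)"
  obtains f s t where "f \<in> G" "s \<noteq> t" "f (g s) = g (s + T)" "f (g t) = g (t + T)"
proof -
  have "\<exists>f\<in>G. f (g t) = g (t + T)" for t
    using covering_map_eq_iff[OF G] g(2) period by (metis rangeI subsetD)
  then obtain F where F: "\<And>t. F t \<in> G" "\<And>t. F t (g t) = g (t + T)"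
    by metis
  \<comment> \<open>\<open>K\<close> contains the arc over \<open>{0..1}\<close> and its shift by
    \<open>T\<close>, so each \<open>F t\<close> with \<open>t\<close> in \<open>{0..1}\<close> maps
    a point of \<open>K\<close> into \<open>K\<close>.\<close>
  define K where "K = g ` ({0..1} \<union> {T..T + 1})"
  have K: "compact K" "K \<subseteq> hplane"
    using g by (auto simp: K_def intro!: compact_continuous_image compact_Un intro: continuous_on_subset)
  have "F ` {0..1} \<subseteq> {f \<in> G. f ` K \<inter> K \<noteq> {}}"
  proof safe
    fix t :: real assume t: "t \<in> {0..1}"
    show "F t \<in> G" using F by simp
    assume "F t ` K \<inter> K = {}"
    moreover have "g t \<in> K" "F t (g t) \<in> K"
      using t F(2) by (auto simp: K_def)
    ultimately show False by blast
  qed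
  moreover have "finite {f \<in> G. f ` K \<inter> K \<noteq> {}}"
    using G K by (simp add: surface_group_def)
  ultimately have "finite (F ` {0..1})"
    by (rule finite_subset)
  moreover have "infinite {0..1::real}"
    by (simp add: infinite_Icc)
  ultimately have "\<not> inj_on F {0..1}"
    using finite_imageD by blast
  then obtain s t where "s \<noteq> t" "F s = F t"
    by (auto simp: inj_on_def)
  with F that show thesis by metis
qed

section \<open>Projection onto the imaginary axis\<close>

definition imaginary_axis :: "real \<Rightarrow> complex" where
  "imaginary_axis t = \<i> * of_real (exp t)"

lemma unit_speed_geodesic_imaginary_axis: "unit_speed_geodesic imaginary_axis"
proof -
  have "hdist (imaginary_axis s) (imaginary_axis t) = \<bar>s - t\<bar>" for s t
  proof -
    have "(cmod (imaginary_axis s - imaginary_axis t))\<^sup>2 = (exp s - exp t)\<^sup>2"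
      by (simp add: imaginary_axis_def cmod_power2)
    then have "1 + (cmod (imaginary_axis s - imaginary_axis t))\<^sup>2 /
        (2 * Im (imaginary_axis s) * Im (imaginary_axis t)) = cosh (s - t)"
      by (simp add: imaginary_axis_def cosh_def exp_diff field_simps power2_eq_square exp_minus)
    also have "\<dots> = cosh \<bar>s - t\<bar>" by simp
    finally show ?thesis
      unfolding hdist_def by (simp only: arcosh_cosh_real abs_ge_zero)
  qed
  then show ?thesis
    by (simp add: unit_speed_geodesic_def hplane_def imaginary_axis_def)
qed

lemma range_imaginary_axis: "range imaginary_axis = {z \<in> hplane. Re z = 0}"
proof safe
  fix z :: complex assume "z \<in> hplane" "Re z = 0"
  then have "z = imaginary_axis (ln (Im z))"
    by (simp add: imaginary_axis_def hplane_def complex_eq_iff)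
  then show "z \<in> range imaginary_axis" by simp
qed (auto simp: imaginary_axis_def hplane_def)

text \<open>For \<open>r = cmod p\<close>, the quantity to be minimized over the points
  \<open>\<i> * s\<close> equals \<open>(s - r)\<^sup>2 / s\<close> plus a term independent of
  \<open>s\<close>, so the unique minimum is at \<open>s = r\<close>.\<close>

lemma orthogonal_projection_imaginary_axis:
  assumes l: "l \<subseteq> hplane"
  shows "orthogonal_projection l (range imaginary_axis) = (\<lambda>z. \<i> * of_real (cmod z)) ` l"
proof -
  have foot: "(\<forall>q'\<in>range imaginary_axis. hdist p q \<le> hdist p q') \<longleftrightarrow> q = \<i> * of_real (cmod p)"
    if p: "p \<in> hplane" and q: "q \<in> range imaginary_axis" for p q
  proof -
    define r where "r = cmod p"
    have r: "r > 0" using p by (auto simp: r_def hplane_def)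
    have dist: "(cmod (p - \<i> * of_real s))\<^sup>2 / s = (s - r)\<^sup>2 / s + 2 * r - 2 * Im p" if "s > 0" for s
    proof -
      have "(cmod (p - \<i> * of_real s))\<^sup>2 = r\<^sup>2 + s\<^sup>2 - 2 * s * Im p"
        unfolding r_def cmod_power2 by (simp add: power2_eq_square algebra_simps)
      then show ?thesis using that by (simp add: field_simps power2_eq_square)
    qed
    have le: "hdist p (\<i> * of_real s) \<le> hdist p (\<i> * of_real s') \<longleftrightarrow> (s - r)\<^sup>2 / s \<le> (s' - r)\<^sup>2 / s'"
      if "s > 0" "s' > 0" for s s'
      using that p dist by (subst hdist_le_iff) (auto simp: hplane_def)
    obtain s where s: "s > 0" "q = \<i> * of_real s"
      using q exp_gt_zero unfolding imaginary_axis_def by blast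
    show ?thesis
    proof
      assume min: "\<forall>q'\<in>range imaginary_axis. hdist p q \<le> hdist p q'"
      have "\<i> * of_real r \<in> range imaginary_axis"
        using r by (auto simp: range_imaginary_axis hplane_def)
      with min have "hdist p (\<i> * of_real s) \<le> hdist p (\<i> * of_real r)"
        using s by blast
      then have "(s - r)\<^sup>2 / s \<le> 0"
        using le[OF s(1) r] by simp
      then have "(s - r)\<^sup>2 \<le> 0"
        using s(1) by (simp add: divide_le_0_iff)
      then show "q = \<i> * of_real (cmod p)"
        using s by (simp add: r_def)
    next
      assume "q = \<i> * of_real (cmod p)"
      then have q: "q = \<i> * of_real r" by (simp add: r_def)
      show "\<forall>q'\<in>range imaginary_axis. hdist p q \<le> hdist p q'"
        unfolding q imaginary_axis_def using le[OF r] by auto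
    qed
  qed
  have "\<i> * of_real (cmod p) \<in> range imaginary_axis" if "p \<in> l" for p
    using that l by (auto simp: range_imaginary_axis hplane_def)
  then show ?thesis
    unfolding orthogonal_projection_def using foot l by blast
qed

section \<open>Length of segments of the imaginary axis\<close>

lemma real_isometry:
  fixes h :: "real \<Rightarrow> real"
  assumes h: "\<And>s t. \<bar>h s - h t\<bar> = \<bar>s - t\<bar>"
  obtains "\<And>t. h t = h 0 + t" | "\<And>t. h t = h 0 - t"
proof -
  have "h 1 = h 0 + 1 \<or> h 1 = h 0 - 1"
    using h[of 1 0] by linarith
  then show thesis
  proof
    assume "h 1 = h 0 + 1"
    then have "h t = h 0 + t" for t
      using h[of t 0] h[of t 1] by linarith
    then show thesis using that by blast
  next
    assume "h 1 = h 0 - 1"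
    then have "h t = h 0 - t" for t
      using h[of t 0] h[of t 1] by linarith
    then show thesis using that by blast
  qed
qed

text \<open>The parametrization picked by \<open>SOME\<close> differs from
  \<open>imaginary_axis\<close> by an isometry of the reals, that is, by a translation or a
  reflection. Both preserve the length of an interval.\<close>

lemma length_in_imaginary_axis:
  assumes "a \<le> b"
  shows "length_in_line (range imaginary_axis) (imaginary_axis ` {a<..<b}) = b - a"
proof -
  define g where "g = (SOME g. unit_speed_geodesic g \<and> range g = range imaginary_axis)"
  have "unit_speed_geodesic g \<and> range g = range imaginary_axis"
    unfolding g_def by (rule someI[of _ imaginary_axis]) (simp add: unit_speed_geodesic_imaginary_axis)
  then have g: "unit_speed_geodesic g" and "range g = range imaginary_axis" by auto
  then have "\<forall>t. \<exists>u. g t = imaginary_axis u" by (metis rangeE rangeI)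
  then obtain h where h: "\<And>t. g t = imaginary_axis (h t)" by metis
  have iso: "\<bar>h s - h t\<bar> = \<bar>s - t\<bar>" for s t
    using g unit_speed_geodesic_imaginary_axis h by (simp add: unit_speed_geodesic_def)
  have inj: "imaginary_axis s = imaginary_axis t \<longleftrightarrow> s = t" for s t
    by (simp add: imaginary_axis_def)
  have "measure lborel {t. a < h t \<and> h t < b} = b - a"
    using iso
  proof (cases rule: real_isometry)
    case 1
    have "a < h t \<and> h t < b \<longleftrightarrow> t \<in> {a - h 0<..<b - h 0}" for t
      using 1[of t] by auto
    then have "{t. a < h t \<and> h t < b} = {a - h 0<..<b - h 0}" by blast
    then show ?thesis using assms by simp
  next
    case 2
    have "a < h t \<and> h t < b \<longleftrightarrow> t \<in> {h 0 - b<..<h 0 - a}" for t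
      using 2[of t] by auto
    then have "{t. a < h t \<and> h t < b} = {h 0 - b<..<h 0 - a}" by blast
    then show ?thesis using assms by simp
  qed
  moreover have "g -` (imaginary_axis ` {a<..<b}) = {t. a < h t \<and> h t < b}"
    by (auto simp: h inj)
  ultimately show ?thesis
    unfolding length_in_line_def g_def[symmetric] by simp
qed

section \<open>Geodesics with prescribed endpoints and their projections\<close>

text \<open>For \<open>p < q\<close> this is the geodesic that runs from the boundary point
  \<open>p\<close> to the boundary point \<open>q\<close>: the image of the imaginary axis under a
  map taking 0 to \<open>p\<close> and infinity to \<open>q\<close>. The determinant is
  \<open>q - p\<close>, not normalized to 1.\<close>

definition mob_line :: "real \<Rightarrow> real \<Rightarrow> real \<Rightarrow> complex" where
  "mob_line q p t = mob q p 1 1 (imaginary_axis t)"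

lemma imaginary_axis_in_hplane [simp]: "imaginary_axis t \<in> hplane"
  by (simp add: imaginary_axis_def hplane_def)

lemma unit_speed_geodesic_mob_line:
  assumes "p < q"
  shows "unit_speed_geodesic (mob_line q p)"
  using assms unit_speed_geodesic_imaginary_axis
  by (simp add: unit_speed_geodesic_def mob_line_def mob_in_hplane hdist_mob)

lemma continuous_on_imaginary_axis: "continuous_on S imaginary_axis"
  unfolding imaginary_axis_def by (intro continuous_intros)

lemma continuous_on_mob_line:
  assumes "p < q"
  shows "continuous_on S (mob_line q p)"
proof -
  have "continuous_on hplane (mob q p 1 1)"
    using assms by (intro holomorphic_on_imp_continuous_on holomorphic_on_mob) simp
  then show ?thesis
    unfolding mob_line_def
    by (rule continuous_on_compose2[OF _ continuous_on_imaginary_axis]) auto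
qed

text \<open>The squared modulus along the line is the mean of \<open>1 / v\<^sup>2\<close> and
  \<open>v\<^sup>2\<close> with weights \<open>(exp t)\<^sup>2\<close> and 1. The modulus therefore
  takes exactly the values strictly between \<open>1 / v\<close> and \<open>v\<close>, and passing
  to logarithms gives the length.\<close>

lemma projection_length_mob_line:
  assumes v: "v > 1"
  shows "projection_length (range (mob_line (- (1 / v)) (- v))) (range imaginary_axis) = 2 * ln v"
proof -
  let ?g = "mob_line (- (1 / v)) (- v)"
  have norm: "(cmod (?g t))\<^sup>2 = ((exp t)\<^sup>2 / v\<^sup>2 + v\<^sup>2) / ((exp t)\<^sup>2 + 1)" for t
    by (simp add: mob_line_def mob_def imaginary_axis_def norm_divide cmod_power2 power_divide power_mult_distrib add.commute)
  have v1: "1 / v\<^sup>2 < v\<^sup>2"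
    using v by (smt (verit) less_divide_eq_1_pos one_less_power pos2)
  have image: "(\<lambda>z. \<i> * of_real (cmod z)) ` range ?g = imaginary_axis ` {- ln v<..<ln v}"
  proof safe
    fix t
    define r where "r = cmod (?g t)"
    have r2: "r\<^sup>2 * ((exp t)\<^sup>2 + 1) = (exp t)\<^sup>2 / v\<^sup>2 + v\<^sup>2"
      unfolding r_def norm by (simp add: add_nonneg_eq_0_iff)
    have "(1 / v)\<^sup>2 * ((exp t)\<^sup>2 + 1) < r\<^sup>2 * ((exp t)\<^sup>2 + 1)"
      unfolding r2 using v1 by (simp add: algebra_simps power_divide)
    then have "(1 / v)\<^sup>2 < r\<^sup>2"
      by (rule mult_right_less_imp_less) simp
    then have lower: "1 / v < r"
      by (rule power2_less_imp_less) (simp add: r_def)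
    have "r\<^sup>2 * ((exp t)\<^sup>2 + 1) < v\<^sup>2 * ((exp t)\<^sup>2 + 1)"
      unfolding r2 using mult_strict_right_mono[OF v1, of "(exp t)\<^sup>2"] by (simp add: algebra_simps)
    then have "r\<^sup>2 < v\<^sup>2"
      by (rule mult_right_less_imp_less) simp
    then have upper: "r < v"
      by (rule power2_less_imp_less) (use v in simp)
    have r0: "r > 0" using lower v by (smt (verit) divide_pos_pos)
    have "ln (1 / v) < ln r" "ln r < ln v"
      using lower upper v r0 by simp_all
    then have "ln r \<in> {- ln v<..<ln v}"
      using v by (simp add: ln_div)
    moreover have "\<i> * of_real r = imaginary_axis (ln r)"
      using r0 by (simp add: imaginary_axis_def)
    ultimately show "\<i> * of_real (cmod (?g t)) \<in> imaginary_axis ` {- ln v<..<ln v}"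
      unfolding r_def by blast
  next
    fix u assume u: "u \<in> {- ln v<..<ln v}"
    define r where "r = exp u"
    have "exp (- ln v) < r" "r < exp (ln v)"
      using u by (simp_all add: r_def)
    then have r: "1 / v < r" "r < v" "r > 0"
      using v by (simp_all add: exp_minus inverse_eq_divide r_def)
    have r2: "1 / v\<^sup>2 < r\<^sup>2" "r\<^sup>2 < v\<^sup>2"
      using power_strict_mono[OF r(1), of 2] power_strict_mono[OF r(2), of 2] v r by (simp_all add: power_divide)
    \<comment> \<open>\<open>E\<close> is the weight \<open>(exp t)\<^sup>2\<close> at which the
      weighted mean equals \<open>r\<^sup>2\<close>.\<close>
    define E where "E = (v\<^sup>2 - r\<^sup>2) / (r\<^sup>2 - 1 / v\<^sup>2)"
    have E: "E > 0" using r2 by (simp add: E_def)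
    have "(exp (ln E / 2))\<^sup>2 = E"
      using E by (simp flip: exp_of_nat_mult)
    then have "(cmod (?g (ln E / 2)))\<^sup>2 = (E / v\<^sup>2 + v\<^sup>2) / (E + 1)"
      by (simp add: norm)
    also have "\<dots> = r\<^sup>2"
    proof -
      have "E * (r\<^sup>2 - 1 / v\<^sup>2) = v\<^sup>2 - r\<^sup>2"
        using r2 by (simp add: E_def)
      then have "E / v\<^sup>2 + v\<^sup>2 = r\<^sup>2 * (E + 1)"
        by (simp add: algebra_simps)
      then show ?thesis using E by simp
    qed
    finally have "cmod (?g (ln E / 2)) = r"
      using r(3) by (simp add: power2_eq_iff_nonneg)
    then have "imaginary_axis u = \<i> * of_real (cmod (?g (ln E / 2)))"
      by (simp add: imaginary_axis_def r_def)
    then show "imaginary_axis u \<in> (\<lambda>z. \<i> * of_real (cmod z)) ` range ?g"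
      by blast
  qed
  have "- v < - (1 / v)"
    using v by (smt (verit) divide_less_eq_1_pos)
  then have "range ?g \<subseteq> hplane"
    using unit_speed_geodesic_mob_line by (auto simp: unit_speed_geodesic_def)
  then show ?thesis
    using v image length_in_imaginary_axis[of "- ln v" "ln v"]
    by (simp add: projection_length_def orthogonal_projection_imaginary_axis)
qed

section \<open>A quaternion group\<close>

text \<open>The matrix of \<open>x + y i + z j + w k\<close> with \<open>k = i j\<close>, hence
  \<open>k^2 = -8\<close>; its determinant is the reduced norm. The restriction makes the map
  extensional, as \<open>BijGroup\<close> requires.\<close>

definition qmob :: "int \<Rightarrow> int \<Rightarrow> int \<Rightarrow> int \<Rightarrow> complex \<Rightarrow> complex" where
  "qmob x y z w = restrict (mob (x + y * sqrt 8) (z + w * sqrt 8) (z - w * sqrt 8) (x - y * sqrt 8)) hplane"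

definition quaternion_group :: "(complex \<Rightarrow> complex) set" where
  "quaternion_group = {qmob x y z w | x y z w. x\<^sup>2 - 8 * y\<^sup>2 - z\<^sup>2 + 8 * w\<^sup>2 = 1}"

lemma det_qmob:
  fixes x y z w :: int
  assumes "x\<^sup>2 - 8 * y\<^sup>2 - z\<^sup>2 + 8 * w\<^sup>2 = 1"
  shows "(x + y * sqrt 8) * (x - y * sqrt 8) - (z + w * sqrt 8) * (z - w * sqrt 8) = 1"
proof -
  have "real_of_int (x\<^sup>2 - 8 * y\<^sup>2 - z\<^sup>2 + 8 * w\<^sup>2) = 1"
    using assms by simp
  moreover have "(sqrt 8)\<^sup>2 = (8 :: real)" by simp
  ultimately show ?thesis
    unfolding of_int_diff of_int_add of_int_mult of_int_power of_int_numeral by algebra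
qed

lemma qmob_in_Bij:
  assumes "x\<^sup>2 - 8 * y\<^sup>2 - z\<^sup>2 + 8 * w\<^sup>2 = 1"
  shows "qmob x y z w \<in> Bij hplane"
  using bij_betw_mob[OF det_qmob[OF assms]]
  by (simp add: qmob_def Bij_def bij_betw_restrict_eq)

text \<open>The coefficients are those of the quaternion product, obtained from the matrix product
  by replacing \<open>sqrt 8 * sqrt 8\<close> with 8.\<close>

lemma compose_qmob:
  assumes "x'\<^sup>2 - 8 * y'\<^sup>2 - z'\<^sup>2 + 8 * w'\<^sup>2 = 1"
  shows "compose hplane (qmob x y z w) (qmob x' y' z' w') =
    qmob (x * x' + 8 * y * y' + z * z' - 8 * w * w') (x * y' + y * x' - z * w' + w * z')
         (x * z' + 8 * y * w' + z * x' - 8 * w * y') (x * w' + y * z' - z * y' + w * x')"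
proof
  fix p
  have s: "sqrt 8 * (sqrt 8 * t) = 8 * t" for t :: real
    by (simp flip: mult.assoc)
  note det = det_qmob[OF assms]
  show "compose hplane (qmob x y z w) (qmob x' y' z' w') p =
    qmob (x * x' + 8 * y * y' + z * z' - 8 * w * w') (x * y' + y * x' - z * w' + w * z')
         (x * z' + 8 * y * w' + z * x' - 8 * w * y') (x * w' + y * z' - z * y' + w * x') p"
  proof (cases "p \<in> hplane")
    case True
    have eq1: "(x + y * sqrt 8) * (x' + y' * sqrt 8) + (z + w * sqrt 8) * (z' - w' * sqrt 8)
        = real_of_int (x * x' + 8 * y * y' + z * z' - 8 * w * w') + real_of_int (x * y' + y * x' - z * w' + w * z') * sqrt 8"
      by (simp add: algebra_simps s)
    have eq2: "(x + y * sqrt 8) * (z' + w' * sqrt 8) + (z + w * sqrt 8) * (x' - y' * sqrt 8)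
        = real_of_int (x * z' + 8 * y * w' + z * x' - 8 * w * y') + real_of_int (x * w' + y * z' - z * y' + w * x') * sqrt 8"
      by (simp add: algebra_simps s)
    have eq3: "(z - w * sqrt 8) * (x' + y' * sqrt 8) + (x - y * sqrt 8) * (z' - w' * sqrt 8)
        = real_of_int (x * z' + 8 * y * w' + z * x' - 8 * w * y') - real_of_int (x * w' + y * z' - z * y' + w * x') * sqrt 8"
      by (simp add: algebra_simps s)
    have eq4: "(z - w * sqrt 8) * (z' + w' * sqrt 8) + (x - y * sqrt 8) * (x' - y' * sqrt 8)
        = real_of_int (x * x' + 8 * y * y' + z * z' - 8 * w * w') - real_of_int (x * y' + y * x' - z * w' + w * z') * sqrt 8"
      by (simp add: algebra_simps s)
    show ?thesis
      using True det
      by (simp only: qmob_def compose_def restrict_apply if_True mob_in_hplane mob_mob eq1 eq2 eq3 eq4 zero_less_one)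
  next
    case False
    then show ?thesis by (simp add: compose_def qmob_def)
  qed
qed

lemma qmob_one: "qmob 1 0 0 0 = (\<lambda>p\<in>hplane. p)"
  by (auto simp: qmob_def mob_def)

lemma subgroup_quaternion_group: "subgroup quaternion_group (BijGroup hplane)"
proof (rule group.subgroupI[OF group_BijGroup])
  show "quaternion_group \<subseteq> carrier (BijGroup hplane)"
    by (auto simp: quaternion_group_def BijGroup_def qmob_in_Bij)
  have one: "qmob 1 0 0 0 \<in> quaternion_group"
    unfolding quaternion_group_def by force
  then show "quaternion_group \<noteq> {}" by auto
next
  fix f assume "f \<in> quaternion_group"
  then obtain x y z w where f: "f = qmob x y z w" and n: "x\<^sup>2 - 8 * y\<^sup>2 - z\<^sup>2 + 8 * w\<^sup>2 = 1"
    by (auto simp: quaternion_group_def)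
  define h where "h = qmob x (- y) (- z) (- w)"
  have n': "x\<^sup>2 - 8 * (- y)\<^sup>2 - (- z)\<^sup>2 + 8 * (- w)\<^sup>2 = 1"
    using n by simp
  have "compose hplane h f = qmob 1 0 0 0"
    unfolding h_def f compose_qmob[OF n]
    using n by (simp add: power2_eq_square algebra_simps)
  then have "inv\<^bsub>BijGroup hplane\<^esub> f = h"
    using qmob_in_Bij[OF n] qmob_in_Bij[OF n']
    by (intro group.inv_equality[OF group_BijGroup]) (auto simp: BijGroup_def qmob_one f h_def)
  moreover have "h \<in> quaternion_group"
    unfolding quaternion_group_def h_def using n' by blast
  ultimately show "inv\<^bsub>BijGroup hplane\<^esub> f \<in> quaternion_group"
    by simp
next
  fix f g assume "f \<in> quaternion_group" "g \<in> quaternion_group"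
  then obtain x y z w x' y' z' w' where f: "f = qmob x y z w" and g: "g = qmob x' y' z' w'"
    and n: "x\<^sup>2 - 8 * y\<^sup>2 - z\<^sup>2 + 8 * w\<^sup>2 = 1" and n': "x'\<^sup>2 - 8 * y'\<^sup>2 - z'\<^sup>2 + 8 * w'\<^sup>2 = 1"
    by (auto simp: quaternion_group_def)
  \<comment> \<open>Multiplicativity of the reduced norm.\<close>
  have "(x * x' + 8 * y * y' + z * z' - 8 * w * w')\<^sup>2 - 8 * (x * y' + y * x' - z * w' + w * z')\<^sup>2
    - (x * z' + 8 * y * w' + z * x' - 8 * w * y')\<^sup>2 + 8 * (x * w' + y * z' - z * y' + w * x')\<^sup>2
    = (x\<^sup>2 - 8 * y\<^sup>2 - z\<^sup>2 + 8 * w\<^sup>2) * (x'\<^sup>2 - 8 * y'\<^sup>2 - z'\<^sup>2 + 8 * w'\<^sup>2)"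
    by algebra
  also have "\<dots> = 1" using n n' by simp
  finally have "compose hplane f g \<in> quaternion_group"
    unfolding f g compose_qmob[OF n'] quaternion_group_def by blast
  then show "f \<otimes>\<^bsub>BijGroup hplane\<^esub> g \<in> quaternion_group"
    using qmob_in_Bij[OF n] qmob_in_Bij[OF n'] by (simp add: BijGroup_def f g)
qed

section \<open>Freeness and proper discontinuity of the quaternion group\<close>

text \<open>For \<open>x = 0\<close> the norm equation would make -1 a square modulo 8. As the trace
  is \<open>2 * x\<close>, its absolute value is thus at least 2.\<close>

lemma quaternion_norm_one_imp_nonzero:
  fixes x y z w :: int
  assumes n: "x\<^sup>2 - 8 * y\<^sup>2 - z\<^sup>2 + 8 * w\<^sup>2 = 1"
  shows "x \<noteq> 0"
proof
  assume "x = 0"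
  with n have "z\<^sup>2 = 8 * (w\<^sup>2 - y\<^sup>2) - 1" by simp
  then have "z\<^sup>2 mod 8 = 7" by presburger
  moreover have "z\<^sup>2 mod 8 = ((z mod 8)\<^sup>2) mod 8"
    by (simp add: power_mod)
  moreover have "z mod 8 = 0 \<or> z mod 8 = 1 \<or> z mod 8 = 2 \<or> z mod 8 = 3 \<or>
    z mod 8 = 4 \<or> z mod 8 = 5 \<or> z mod 8 = 6 \<or> z mod 8 = 7"
    by presburger
  ultimately show False by auto
qed

text \<open>Bounds for the four matrix entries bound both \<open>i + j * sqrt 8\<close> and
  \<open>i - j * sqrt 8\<close> for each pair of coefficients, hence bound the integers
  \<open>i\<close> and \<open>j\<close> themselves.\<close>

lemma finite_quaternion_group_compact:
  assumes "compact K" "K \<subseteq> hplane"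
  shows "finite {f \<in> quaternion_group. f ` K \<inter> K \<noteq> {}}"
proof (cases "K = {}")
  case False
  obtain R where R: "R > 0" "\<And>p. p \<in> K \<Longrightarrow> cmod p \<le> R"
    using compact_imp_bounded[OF assms(1)] by (auto simp: bounded_pos)
  obtain p0 where p0: "p0 \<in> K" "\<And>p. p \<in> K \<Longrightarrow> Im p0 \<le> Im p"
    using continuous_attains_inf[OF assms(1) False, of Im] by (fastforce intro: continuous_intros)
  define r where "r = Im p0"
  have r: "r > 0" using p0 assms(2) by (auto simp: r_def hplane_def)
  define q where "q = R / r"
  have q: "q > 0" using r R by (simp add: q_def)
  \<comment> \<open>The sum of the four entry bounds of \<open>mob_preimage_bound\<close>, so that
    it dominates each of them.\<close>
  define B where "B = (1 + q) * q + (R * (1 + q) + R * (1 + q) * q) + (1 + q) / r + ((1 + q) + (1 + q) * q)"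
  define I where "I = {- \<lceil>B\<rceil>..\<lceil>B\<rceil>}"
  have "{f \<in> quaternion_group. f ` K \<inter> K \<noteq> {}} \<subseteq> (\<lambda>(x, y, z, w). qmob x y z w) ` (I \<times> I \<times> I \<times> I)"
  proof
    fix f assume "f \<in> {f \<in> quaternion_group. f ` K \<inter> K \<noteq> {}}"
    then obtain x y z w p where f: "f = qmob x y z w" and n: "x\<^sup>2 - 8 * y\<^sup>2 - z\<^sup>2 + 8 * w\<^sup>2 = 1"
      and p: "p \<in> K" "f p \<in> K"
      unfolding quaternion_group_def by blast
    have fp: "f p = mob (x + y * sqrt 8) (z + w * sqrt 8) (z - w * sqrt 8) (x - y * sqrt 8) p"
      using p assms(2) by (auto simp: f qmob_def)
    have "Im p \<ge> r" "Im (f p) \<ge> r" "cmod p \<le> R" "cmod (f p) \<le> R"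
      using p p0 R by (auto simp: r_def)
    note bounds = mob_preimage_bound[OF det_qmob[OF n] r R(1) this(3,1) this(4,2)[unfolded fp], folded q_def]
    have "\<bar>x + y * sqrt 8\<bar> \<le> B" "\<bar>z + w * sqrt 8\<bar> \<le> B" "\<bar>z - w * sqrt 8\<bar> \<le> B" "\<bar>x - y * sqrt 8\<bar> \<le> B"
      using bounds r q R(1) unfolding B_def
      by (smt (verit) mult_nonneg_nonneg divide_nonneg_pos add_nonneg_nonneg)+
    moreover have "i \<in> I \<and> j \<in> I" if "\<bar>i + j * sqrt 8\<bar> \<le> B" "\<bar>i - j * sqrt 8\<bar> \<le> B" for i j :: int
    proof -
      have "\<bar>real_of_int i\<bar> \<le> B" and j: "\<bar>j * sqrt 8\<bar> \<le> B"
        using that by linarith+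
      have "\<bar>real_of_int j\<bar> * 1 \<le> \<bar>real_of_int j\<bar> * sqrt 8"
        by (intro mult_left_mono) auto
      with j have "\<bar>real_of_int j\<bar> \<le> B"
        by (simp add: abs_mult)
      with \<open>\<bar>real_of_int i\<bar> \<le> B\<close> show ?thesis
        unfolding I_def atLeastAtMost_iff by linarith
    qed
    ultimately show "f \<in> (\<lambda>(x, y, z, w). qmob x y z w) ` (I \<times> I \<times> I \<times> I)"
      unfolding f by (intro image_eqI[of _ _ "(x, y, z, w)"]) auto
  qed
  then show ?thesis
    by (rule finite_subset) (simp add: I_def)
qed simp

lemma surface_group_quaternion_group: "surface_group quaternion_group"
proof -
  have free: "f = (\<lambda>x\<in>hplane. x)"
    if f: "f \<in> quaternion_group" and p: "p \<in> hplane" "f p = p" for f p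
  proof -
    from f obtain x y z w where f: "f = qmob x y z w" and n: "x\<^sup>2 - 8 * y\<^sup>2 - z\<^sup>2 + 8 * w\<^sup>2 = 1"
      by (auto simp: quaternion_group_def)
    note det = det_qmob[OF n]
    have "1 \<le> x\<^sup>2"
      using quaternion_norm_one_imp_nonzero[OF n] by (smt (verit) zero_less_power2)
    then have "1 \<le> (real_of_int x)\<^sup>2"
      by (metis of_int_1_le_iff of_int_power)
    then have "4 \<le> ((x + y * sqrt 8) + (x - y * sqrt 8))\<^sup>2"
      by (simp add: power2_eq_square)
    from mob_fixed_point[OF det p(1) _ this]
    have eq: "z + w * sqrt 8 = 0" "z - w * sqrt 8 = 0" "x - y * sqrt 8 = x + y * sqrt 8"
      using p by (auto simp: f qmob_def)
    then have 0: "y = 0" "z = 0" "w = 0" by auto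
    \<comment> \<open>The matrices 1 and -1 both act as the identity.\<close>
    with n have "x = 1 \<or> x = - 1"
      by (simp add: power2_eq_1_iff)
    with 0 show ?thesis
      by (auto simp: f qmob_def mob_def)
  qed
  have "orientation_preserving_isometry f" if "f \<in> quaternion_group" for f
    using that orientation_preserving_isometry_mob[OF det_qmob]
    by (auto simp: quaternion_group_def qmob_def)
  then show ?thesis
    unfolding surface_group_def
    using free subgroup_quaternion_group finite_quaternion_group_compact by blast
qed

section \<open>Translation lengths along axes\<close>

text \<open>Translating two points of the line along it forces the matrix to have the eigenvectors
  \<open>(q, 1)\<close> and \<open>(p, 1)\<close>, with eigenvalues \<open>B1\<close> and
  \<open>B0\<close> of ratio \<open>exp T\<close> and product 1. The endpoints are then roots of
  \<open>c x^2 + (d - a) x - b\<close>, so \<open>p * q = 1\<close> gives \<open>b = - c\<close>,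
  while \<open>c * (q - p)\<close> is the difference of the eigenvalues.\<close>

lemma mob_translation_entries:
  assumes det: "a * d - b * c = 1" and qp: "p < q" "p * q = 1" and st: "s \<noteq> t"
    and "mob a b c d (mob_line q p s) = mob_line q p (s + T)"
    and "mob a b c d (mob_line q p t) = mob_line q p (t + T)"
  shows "b = - c" "\<bar>c\<bar> * (q - p) = \<bar>exp (T / 2) - exp (- T / 2)\<bar>"
proof -
  \<comment> \<open>These are the rows of the product of \<open>(a, b; c, d)\<close> with the matrix
    \<open>(q, p; 1, 1)\<close> that defines the line.\<close>
  define A1 A0 B1 B0 where "A1 = a * q + b" and "A0 = a * p + b" and "B1 = c * q + d" and "B0 = c * p + d"
  define L where "L = exp T"
  have L: "L > 0" by (simp add: L_def)
  have detAB: "A1 * B0 - A0 * B1 = q - p"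
    using det unfolding A1_def A0_def B1_def B0_def by algebra
  have eqs: "A0 - p * B0 = L * (exp t)\<^sup>2 * (A1 - q * B1)" "A1 + L * A0 = q * L * B0 + p * B1"
    if "mob a b c d (mob_line q p t) = mob_line q p (t + T)" for t
  proof -
    define y where "y = exp t"
    have y: "y > 0" by (simp add: y_def)
    have "mob a b c d (mob_line q p t) = mob A1 A0 B1 B0 (imaginary_axis t)"
      using qp by (simp add: mob_line_def mob_mob A1_def A0_def B1_def B0_def)
    with that have eq: "mob A1 A0 B1 B0 (imaginary_axis t) = mob q p 1 1 (imaginary_axis (t + T))"
      by (simp add: mob_line_def)
    have "of_real B1 * imaginary_axis t + of_real B0 \<noteq> 0"
      using qp detAB by (intro mob_denominator_nonzero[of A1 B0 A0]) auto
    moreover have "of_real 1 * imaginary_axis (t + T) + of_real 1 \<noteq> 0"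
      using qp by (intro mob_denominator_nonzero[of q 1 p]) auto
    ultimately have "(of_real A1 * imaginary_axis t + of_real A0) * (imaginary_axis (t + T) + 1)
        = (of_real q * imaginary_axis (t + T) + of_real p) * (of_real B1 * imaginary_axis t + of_real B0)"
      using eq unfolding mob_def by (simp add: frac_eq_eq)
    moreover have "imaginary_axis t = Complex 0 y" "imaginary_axis (t + T) = Complex 0 (L * y)"
      by (simp_all add: imaginary_axis_def complex_eq_iff y_def L_def exp_add)
    ultimately have re: "A0 - A1 * y * (L * y) = p * B0 - q * (L * y) * (B1 * y)"
      and im: "A1 * y + A0 * (L * y) = q * (L * y) * B0 + p * (B1 * y)"
      by (simp_all add: complex_eq_iff)
    from re show "A0 - p * B0 = L * (exp t)\<^sup>2 * (A1 - q * B1)"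
      unfolding y_def[symmetric] by algebra
    from im have "y * (A1 + L * A0) = y * (q * L * B0 + p * B1)"
      by algebra
    with y show "A1 + L * A0 = q * L * B0 + p * B1"
      by simp
  qed
  \<comment> \<open>By the first equation both sides equal \<open>A0 - p * B0\<close>, which does
    not depend on the parameter. Two different parameters are compatible only if
    \<open>A1 - q * B1\<close> vanishes.\<close>
  have "L * (exp s)\<^sup>2 * (A1 - q * B1) = L * (exp t)\<^sup>2 * (A1 - q * B1)"
    by (rule trans[OF eqs(1)[OF assms(5), symmetric] eqs(1)[OF assms(6)]])
  moreover have "L * (exp s)\<^sup>2 \<noteq> L * (exp t)\<^sup>2"
    using st L by (simp add: power2_eq_iff_nonneg)
  ultimately have A1: "A1 = q * B1"
    by (metis eq_iff_diff_eq_0 mult_cancel_right)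
  then have A0: "A0 = p * B0"
    using eqs(1)[OF assms(5)] by simp
  have "(q - p) * B1 = (q - p) * (L * B0)"
    using eqs(2)[OF assms(5)] unfolding A0 A1 by algebra
  then have B1: "B1 = L * B0" using qp by simp
  have "(q - p) * (B1 * B0) = (q - p) * 1"
    using detAB unfolding A0 A1 by algebra
  then have "B1 * B0 = 1" using qp by simp
  then have "L * B0\<^sup>2 = 1"
    by (simp add: B1 power2_eq_square)
  moreover have L2: "L = (exp (T / 2))\<^sup>2"
    by (simp add: L_def flip: exp_of_nat_mult)
  ultimately have "(exp (T / 2) * B0)\<^sup>2 = 1"
    by (simp add: power_mult_distrib)
  then have B0: "\<bar>exp (T / 2) * B0\<bar> = 1"
    by (simp add: abs_square_eq_1)
  have "(q - p) * a = (q - p) * (c * (q + p) + d)"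
    using A1 A0 unfolding A1_def A0_def B1_def B0_def by algebra
  then have "a = c * (q + p) + d" using qp by simp
  then show "b = - c"
    using A1 qp(2) unfolding A1_def B1_def by algebra
  have "c * (q - p) = (exp (T / 2) * B0) * (exp (T / 2) - exp (- T / 2))"
  proof -
    have "c * (q - p) = B1 - B0"
      unfolding B1_def B0_def by algebra
    moreover have "exp (T / 2) * exp (- T / 2) = 1"
      by (simp flip: exp_add)
    ultimately show ?thesis
      unfolding B1 L2 by algebra
  qed
  then have "\<bar>c * (q - p)\<bar> = \<bar>exp (T / 2) - exp (- T / 2)\<bar>"
    using B0 by (simp add: abs_mult)
  then show "\<bar>c\<bar> * (q - p) = \<bar>exp (T / 2) - exp (- T / 2)\<bar>"
    using qp by (simp add: abs_mult)
qed

text \<open>By integrality, the off-diagonal entry in the previous lemma is a nonzero multiple of \<open>sqrt 8\<close>.\<close>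

lemma quaternion_group_translation_bound:
  assumes f: "f \<in> quaternion_group" and qp: "p < q" "p * q = 1" and st: "s \<noteq> t" and T: "T > 0"
    and fs: "f (mob_line q p s) = mob_line q p (s + T)"
    and ft: "f (mob_line q p t) = mob_line q p (t + T)"
  shows "sqrt 8 * (q - p) \<le> exp (T / 2) - exp (- T / 2)"
proof -
  from f obtain x y z w where f: "f = qmob x y z w" and n: "x\<^sup>2 - 8 * y\<^sup>2 - z\<^sup>2 + 8 * w\<^sup>2 = 1"
    by (auto simp: quaternion_group_def)
  have "mob_line q p t \<in> hplane" for t
    using unit_speed_geodesic_mob_line[OF qp(1)] by (simp add: unit_speed_geodesic_def)
  then have "mob (x + y * sqrt 8) (z + w * sqrt 8) (z - w * sqrt 8) (x - y * sqrt 8) (mob_line q p t)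
      = f (mob_line q p t)" for t
    by (simp add: f qmob_def)
  note entries = mob_translation_entries[OF det_qmob[OF n] qp st, unfolded this, OF fs ft]
  \<comment> \<open>Here \<open>b = - c\<close> reads
    \<open>z + w * sqrt 8 = - z + w * sqrt 8\<close>.\<close>
  have z: "z = 0" using entries(1) by simp
  have pos: "exp (T / 2) - exp (- T / 2) > 0"
    using T by simp
  have eq: "\<bar>real_of_int w\<bar> * (sqrt 8 * (q - p)) = exp (T / 2) - exp (- T / 2)"
    using entries(2) pos by (simp add: z abs_mult)
  with pos have "w \<noteq> 0" by auto
  then have "1 \<le> \<bar>real_of_int w\<bar>" by linarith
  then have "1 * (sqrt 8 * (q - p)) \<le> \<bar>real_of_int w\<bar> * (sqrt 8 * (q - p))"
    using qp by (intro mult_right_mono) auto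
  with eq show ?thesis by simp
qed

section \<open>The Pell family of closed geodesics\<close>

text \<open>Starting from \<open>(5, 2)\<close>, the number \<open>X + Y * sqrt 8\<close> of norm -7
  is multiplied repeatedly by the unit \<open>3 + sqrt 8\<close> of norm 1; \<open>Y\<close> grows
  by at least 1 each time.\<close>

lemma pell_solutions_unbounded:
  "\<exists>X Y :: int. X > 0 \<and> Y \<ge> int n + 2 \<and> X\<^sup>2 = 8 * Y\<^sup>2 - 7"
proof (induction n)
  case 0
  show ?case by (rule exI[of _ 5], rule exI[of _ 2]) simp
next
  case (Suc n)
  then obtain X Y :: int where XY: "X > 0" "Y \<ge> int n + 2" "X\<^sup>2 = 8 * Y\<^sup>2 - 7" by blast
  have "(3 * X + 8 * Y)\<^sup>2 = 8 * (X + 3 * Y)\<^sup>2 - 7"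
    using XY(3) by algebra
  with XY(1,2) show ?case
    by (intro exI[of _ "3 * X + 8 * Y"] exI[of _ "X + 3 * Y"]) auto
qed

text \<open>The line with endpoints \<open>- Y \<plusminus> sqrt (Y\<^sup>2 - 1)\<close> is the axis of the element with matrix
  \<open>(X - Y * s, - s; s, X + Y * s)\<close>, where \<open>s = sqrt 8\<close>, which has eigenvalue \<open>X + s * sqrt (Y\<^sup>2 - 1)\<close>.\<close>

lemma pell_closed_geodesic:
  fixes X Y :: int and R :: real
  assumes X: "X > 0" and Y: "Y \<ge> 2" and XY: "X\<^sup>2 = 8 * Y\<^sup>2 - 7"
  defines "R \<equiv> sqrt ((real_of_int Y)\<^sup>2 - 1)"
  defines "c \<equiv> covering_map quaternion_group \<circ> mob_line (- (Y - R)) (- (Y + R))"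
  shows "closed_geodesic quaternion_group c" "geodesic_length c = 2 * ln (X + sqrt 8 * R)"
proof -
  define q p where "q = - (Y - R)" and "p = - (Y + R)"
  define s where "s = sqrt 8"
  define E where "E = X + s * R"
  have Y2: "(real_of_int Y)\<^sup>2 \<ge> 4"
    using Y power_mono[of 2 "real_of_int Y" 2] by simp
  have R: "R > 0" "R\<^sup>2 = (real_of_int Y)\<^sup>2 - 1"
    using Y2 by (simp_all add: R_def)
  have s: "s > 0" "s\<^sup>2 = 8" by (simp_all add: s_def)
  have qp: "p < q" "p * q = 1" "q - p = 2 * R"
    using R by (auto simp: p_def q_def algebra_simps power2_eq_square)
  have E: "E > 1"
    using X R s by (simp add: E_def add_strict_increasing2 mult_pos_pos less_add_same_cancel1
      order.strict_trans1[of 1 "real_of_int X"])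
  have XY': "(real_of_int X)\<^sup>2 = 8 * (real_of_int Y)\<^sup>2 - 7"
    using XY by (metis of_int_diff of_int_mult of_int_numeral of_int_power)
  have "E * (X - s * R) = 1"
    unfolding E_def using R(2) s(2) XY' by algebra
  then have Einv: "1 / E = X - s * R"
    using E by (simp add: field_simps)
  \<comment> \<open>The quaternion \<open>X - Y i - k\<close>; its norm
    \<open>X\<^sup>2 - 8 * Y\<^sup>2 + 8\<close> is 1 by the Pell equation.\<close>
  define f where "f = qmob X (- Y) 0 (- 1)"
  have f: "f \<in> quaternion_group"
    unfolding quaternion_group_def f_def using XY by force
  have sY: "s * (real_of_int Y * real_of_int Y) = s + R * (R * s)"
    using R(2) by algebra
  \<comment> \<open>The columns \<open>(q, 1)\<close> and \<open>(p, 1)\<close> are eigenvectors of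
    the matrix of \<open>f\<close>, with eigenvalues \<open>E\<close> and
    \<open>1 / E\<close>.\<close>
  have entries: "(X - Y * s) * q + - s = q * E" "(X - Y * s) * p + - s = p * (1 / E)"
    "s * q + (X + Y * s) = E" "s * p + (X + Y * s) = 1 / E"
    unfolding Einv unfolding E_def p_def q_def using s(2) by (simp_all add: algebra_simps power2_eq_square sY)
  have move: "f (mob_line q p t) = mob_line q p (t + 2 * ln E)" for t
  proof -
    have "f (mob_line q p t) = mob (X - Y * s) (- s) s (X + Y * s) (mob q p 1 1 (imaginary_axis t))"
      using qp mob_in_hplane[of q 1 p 1] by (simp add: f_def qmob_def s_def mob_line_def)
    also have "\<dots> = mob (q * E) (p * (1 / E)) E (1 / E) (imaginary_axis t)"
      using qp by (simp only: mob_mob imaginary_axis_in_hplane mult_1_right diff_gt_0_iff_gt entries)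
    \<comment> \<open>Expanding the fraction by \<open>E\<close> exhibits the motion as
      multiplication of the axis parameter point by \<open>E\<^sup>2\<close>, a translation by
      \<open>2 * ln E\<close>.\<close>
    also have "\<dots> = (E * (q * E * imaginary_axis t + p * (1 / E))) / (E * (E * imaginary_axis t + 1 / E))"
      using E by (simp add: mob_def)
    also have "E * (q * E * imaginary_axis t + p * (1 / E)) = q * (E\<^sup>2 * imaginary_axis t) + p"
      using E by (simp add: distrib_left power2_eq_square)
    also have "E * (E * imaginary_axis t + 1 / E) = E\<^sup>2 * imaginary_axis t + 1"
      using E by (simp add: distrib_left power2_eq_square)
    also have "(q * (E\<^sup>2 * imaginary_axis t) + p) / (E\<^sup>2 * imaginary_axis t + 1) = mob q p 1 1 (E\<^sup>2 * imaginary_axis t)"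
      by (simp add: mob_def)
    also have "E\<^sup>2 * imaginary_axis t = imaginary_axis (t + 2 * ln E)"
      using E by (simp add: imaginary_axis_def exp_add exp_double)
    finally show ?thesis
      by (simp add: mob_line_def)
  qed
  have c: "c = covering_map quaternion_group \<circ> mob_line q p"
    by (simp add: c_def q_def p_def)
  note G = surface_group_quaternion_group
  have line: "unit_speed_geodesic (mob_line q p)" "continuous_on UNIV (mob_line q p)"
    using qp unit_speed_geodesic_mob_line continuous_on_mob_line by auto
  show "closed_geodesic quaternion_group c"
    unfolding c using E move by (intro closed_geodesic_covering_map[OF G line _ f]) auto
  have hplane: "mob_line q p t \<in> hplane" for t
    using line(1) by (simp add: unit_speed_geodesic_def)
  have "geodesic_length c = 2 * ln E"
    unfolding geodesic_length_def
  proof (rule cInf_eq_minimum)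
    have "c (t + 2 * ln E) = c t" for t
      using covering_map_eq_iff[OF G hplane hplane] f move unfolding c comp_def by metis
    then show "2 * ln E \<in> {T. T > 0 \<and> (\<forall>t. c (t + T) = c t)}"
      using E by simp
  next
    fix T assume "T \<in> {T. T > 0 \<and> (\<forall>t. c (t + T) = c t)}"
    then have T: "T > 0" "\<And>t. c (t + T) = c t" by auto
    \<comment> \<open>Minimality of the period: every period \<open>T\<close> comes from a group
      element moving two points of the line by \<open>T\<close>, so the integrality bound applies to
      it.\<close>
    obtain h s' t where h: "h \<in> quaternion_group" "s' \<noteq> t"
      "h (mob_line q p s') = mob_line q p (s' + T)" "h (mob_line q p t) = mob_line q p (t + T)"
      using surface_group_translation[OF G line(2), of T] hplane T(2) unfolding c comp_def by blast
    have "s * (2 * R) \<le> exp (T / 2) - exp (- T / 2)"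
      using quaternion_group_translation_bound[OF h(1) qp(1,2) h(2) T(1) h(3,4)]
      by (simp add: qp(3) s_def)
    moreover have "E - 1 / E = s * (2 * R)"
      using Einv E_def by linarith
    ultimately have le: "E - 1 / E \<le> exp (T / 2) - 1 / exp (T / 2)"
      by (simp add: exp_minus inverse_eq_divide)
    \<comment> \<open>The function \<open>x - 1 / x\<close> is strictly increasing for positive
      \<open>x\<close>.\<close>
    have "E \<le> exp (T / 2)"
    proof (rule ccontr)
      assume "\<not> E \<le> exp (T / 2)"
      then have "exp (T / 2) < E" "1 / E < 1 / exp (T / 2)"
        using E by (auto intro: divide_strict_left_mono)
      with le show False by linarith
    qed
    then have "ln E \<le> T / 2"
      using E ln_mono[of E "exp (T / 2)"] by simp
    then show "2 * ln E \<le> T" by simp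
  qed
  then show "geodesic_length c = 2 * ln (X + sqrt 8 * R)"
    by (simp add: E_def s_def)
qed

text \<open>The quaternion \<open>3 + i\<close> has the diagonal matrix with entries
  \<open>3 + sqrt 8\<close> and \<open>3 - sqrt 8\<close>, which are inverse to each other, so it
  acts as a dilation and translates the imaginary axis.\<close>

lemma closed_geodesic_imaginary_axis:
  "closed_geodesic quaternion_group (covering_map quaternion_group \<circ> imaginary_axis)"
proof (rule closed_geodesic_covering_map[OF surface_group_quaternion_group
      unit_speed_geodesic_imaginary_axis continuous_on_imaginary_axis])
  show "qmob 3 1 0 0 \<in> quaternion_group"
    unfolding quaternion_group_def by force
  show "0 < 2 * ln (3 + sqrt 8 :: real)"
    by (simp add: add_strict_increasing2)
  fix t
  define E :: real where "E = 3 + sqrt 8"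
  have E: "E > 0" by (simp add: E_def add_pos_nonneg)
  have "(3 - sqrt 8) * E = 1"
    by (simp add: E_def algebra_simps)
  then have inv: "3 - sqrt 8 = 1 / E"
    by (rule nonzero_eq_divide_eq[THEN iffD2, rotated]) (use E in simp)
  have "qmob 3 1 0 0 (imaginary_axis t) = mob E 0 0 (1 / E) (imaginary_axis t)"
    by (simp add: qmob_def inv flip: E_def)
  also have "\<dots> = E\<^sup>2 * imaginary_axis t"
    by (simp add: mob_def power2_eq_square)
  also have "\<dots> = imaginary_axis (t + 2 * ln E)"
    using E by (simp add: imaginary_axis_def exp_add exp_double)
  finally show "qmob 3 1 0 0 (imaginary_axis t) = imaginary_axis (t + 2 * ln (3 + sqrt 8))"
    by (simp add: E_def)
qed

section \<open>The limit of the ratio\<close>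

text \<open>Closedness provides a positive period, so the infimum is over a nonempty set of positive
  numbers.\<close>

lemma geodesic_length_nonneg:
  assumes "closed_geodesic G c"
  shows "0 \<le> geodesic_length c"
  unfolding geodesic_length_def
  using assms by (intro cInf_greatest) (auto simp: closed_geodesic_def)

lemma line_above_range:
  assumes "unit_speed_geodesic g"
  shows "line_above G (covering_map G \<circ> g) (range g)"
  using assms by (auto simp: line_above_def geodesic_line_def unit_speed_geodesic_def)

theorem mainTheorem7:
  shows "\<exists>(G :: nat \<Rightarrow> (complex \<Rightarrow> complex) set)
           (\<gamma> :: nat \<Rightarrow> real \<Rightarrow> complex set) (\<delta> :: nat \<Rightarrow> real \<Rightarrow> complex set)
           (l :: nat \<Rightarrow> complex set) (m :: nat \<Rightarrow> complex set).
    (\<forall>n. surface_group (G n) \<and>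
         closed_geodesic (G n) (\<gamma> n) \<and> closed_geodesic (G n) (\<delta> n) \<and>
         line_above (G n) (\<gamma> n) (l n) \<and> line_above (G n) (\<delta> n) (m n) \<and>
         l n \<noteq> m n) \<and>
    (\<lambda>n. projection_length (l n) (m n) / (geodesic_length (\<gamma> n) + geodesic_length (\<delta> n)))
      \<longlonglongrightarrow> 1"
proof -
  obtain X Y :: "nat \<Rightarrow> int" where XY: "\<And>n. X n > 0" "\<And>n. Y n \<ge> int n + 2" "\<And>n. (X n)\<^sup>2 = 8 * (Y n)\<^sup>2 - 7"
    using pell_solutions_unbounded by metis
  have Y2: "Y n \<ge> 2" for n using XY(2)[of n] by simp
  define R where "R n = sqrt ((real_of_int (Y n))\<^sup>2 - 1)" for n
  define v where "v n = Y n + R n" for n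
  define g where "g n = mob_line (- (Y n - R n)) (- (Y n + R n))" for n
  define \<gamma> where "\<gamma> n = covering_map quaternion_group \<circ> g n" for n
  \<comment> \<open>The surface and \<open>\<delta>\<close> stay fixed; only
    \<open>\<gamma> n\<close> varies.\<close>
  define \<delta> where "\<delta> = covering_map quaternion_group \<circ> imaginary_axis"
  define C where "C = geodesic_length \<delta>"
  have Ysq: "(real_of_int (Y n))\<^sup>2 \<ge> 4" for n
    using Y2[of n] power_mono[of 2 "real_of_int (Y n)" 2] by simp
  have R: "R n > 0" "(R n)\<^sup>2 = (real_of_int (Y n))\<^sup>2 - 1" for n
    using Ysq[of n] by (simp_all add: R_def)
  have v: "v n \<ge> real n + 2" "v n > 1" for n
    using XY(2)[of n] R(1)[of n] by (auto simp: v_def)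
  \<comment> \<open>This brings the endpoints into the form \<open>- (1 / v)\<close> and
    \<open>- v\<close> of the projection lemma.\<close>
  have "(Y n - R n) * v n = 1" for n
    using R(2)[of n] by (simp add: v_def algebra_simps power2_eq_square)
  then have inv: "Y n - R n = 1 / v n" for n
    using v(2)[of n] by (simp add: eq_divide_eq)
  have g: "g n = mob_line (- (1 / v n)) (- v n)" for n
    unfolding g_def inv[symmetric] by (simp add: v_def)
  have g_line: "unit_speed_geodesic (g n)" for n
    unfolding g_def using R(1)[of n] by (intro unit_speed_geodesic_mob_line) simp
  have \<gamma>: "closed_geodesic quaternion_group (\<gamma> n)"
    "geodesic_length (\<gamma> n) = 2 * ln (X n + sqrt 8 * R n)" for n
    using pell_closed_geodesic[OF XY(1) Y2 XY(3), of n] by (simp_all add: \<gamma>_def g_def R_def)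
  have \<delta>: "closed_geodesic quaternion_group \<delta>"
    unfolding \<delta>_def by (rule closed_geodesic_imaginary_axis)
  have C: "C \<ge> 0" unfolding C_def using geodesic_length_nonneg[OF \<delta>] .
  have proj: "projection_length (range (g n)) (range imaginary_axis) = 2 * ln (v n)" for n
    unfolding g using projection_length_mob_line[OF v(2)] .
  have distinct: "range (g n) \<noteq> range imaginary_axis" for n
  proof
    assume "range (g n) = range imaginary_axis"
    then have "g n 0 \<in> range imaginary_axis" by blast
    then have "Re (g n 0) = 0" by (auto simp: imaginary_axis_def)
    \<comment> \<open>The point at parameter 0 is the top of the semicircle, above the midpoint of
      the two endpoints.\<close>
    moreover have "Re (g n 0) = - Y n"
      by (simp add: g_def mob_line_def mob_def imaginary_axis_def Re_divide)
    ultimately show False using Y2[of n] by simp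
  qed
  \<comment> \<open>From \<open>Y \<le> X \<le> 3 * Y\<close> and
    \<open>1 \<le> sqrt 8 \<le> 3\<close> the eigenvalue \<open>X + sqrt 8 * R\<close> lies between
    \<open>v\<close> and \<open>3 * v\<close>, so length and projection length differ by at most
    \<open>2 * ln 3\<close>.\<close>
  have length_bounds: "2 * ln (v n) \<le> geodesic_length (\<gamma> n)"
    "geodesic_length (\<gamma> n) \<le> 2 * ln (v n) + 2 * ln 3" for n
  proof -
    have "real_of_int ((X n)\<^sup>2) = real_of_int (8 * (Y n)\<^sup>2 - 7)"
      by (simp only: XY(3))
    then have X2: "(real_of_int (X n))\<^sup>2 = 8 * (real_of_int (Y n))\<^sup>2 - 7" by simp
    have pos: "X n > 0" "real_of_int (Y n) > 0" "R n > 0"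
      using XY(1)[of n] Y2[of n] R(1)[of n] by auto
    have "real_of_int (Y n) \<le> real_of_int (X n)"
      by (rule power2_le_imp_le) (use X2 Ysq[of n] pos in auto)
    moreover have "real_of_int (X n) \<le> 3 * real_of_int (Y n)"
      by (rule power2_le_imp_le) (use X2 Ysq[of n] pos in \<open>auto simp: power_mult_distrib\<close>)
    moreover have "1 \<le> sqrt (8 :: real)" "sqrt 8 \<le> (3 :: real)"
      by (auto intro: real_le_lsqrt)
    then have "1 * R n \<le> sqrt 8 * R n" "sqrt 8 * R n \<le> 3 * R n"
      using pos by (auto intro: mult_right_mono)
    ultimately have "v n \<le> X n + sqrt 8 * R n" "X n + sqrt 8 * R n \<le> v n * 3"
      by (auto simp: v_def)
    then have "ln (v n) \<le> ln (X n + sqrt 8 * R n)" "ln (X n + sqrt 8 * R n) \<le> ln (v n * 3)"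
      using v(2)[of n] by auto
    moreover have "ln (v n * 3) = ln (v n) + ln 3"
      using v(2)[of n] by (simp add: ln_mult)
    ultimately show "2 * ln (v n) \<le> geodesic_length (\<gamma> n)"
      "geodesic_length (\<gamma> n) \<le> 2 * ln (v n) + 2 * ln 3"
      by (auto simp: \<gamma>(2))
  qed
  have ln_v: "ln (v n) > 0" for n using v(2)[of n] by simp
  have "filterlim (\<lambda>n. ln (v n)) at_top sequentially"
  proof (rule filterlim_at_top_mono)
    show "filterlim (\<lambda>n. ln (real n + 2)) at_top sequentially" by real_asymp
    show "\<forall>\<^sub>F n in sequentially. ln (real n + 2) \<le> ln (v n)"
      using v by (intro always_eventually allI ln_mono) auto
  qed
  moreover have "((\<lambda>x. 2 * x / (2 * x + 2 * ln 3 + C)) \<longlongrightarrow> 1) at_top"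
    by real_asymp
  ultimately have lower: "(\<lambda>n. 2 * ln (v n) / (2 * ln (v n) + 2 * ln 3 + C)) \<longlonglongrightarrow> 1"
    by (rule filterlim_compose[rotated])
  have "(\<lambda>n. projection_length (range (g n)) (range imaginary_axis) / (geodesic_length (\<gamma> n) + geodesic_length \<delta>))
      \<longlonglongrightarrow> 1"
  \<comment> \<open>The upper length bound and the constant \<open>C\<close> give the lower estimate
    of the ratio, which tends to 1 as \<open>ln (v n)\<close> grows; the lower length bound and
    \<open>C \<ge> 0\<close> give the upper estimate 1.\<close>
  proof (rule tendsto_sandwich[OF _ _ lower tendsto_const])
    have "2 * ln (v n) / (2 * ln (v n) + 2 * ln 3 + C) \<le> 2 * ln (v n) / (geodesic_length (\<gamma> n) + C)" for n
      using length_bounds[of n] ln_v[of n] C by (intro divide_left_mono mult_pos_pos) auto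
    then show "\<forall>\<^sub>F n in sequentially. 2 * ln (v n) / (2 * ln (v n) + 2 * ln 3 + C)
      \<le> projection_length (range (g n)) (range imaginary_axis) / (geodesic_length (\<gamma> n) + geodesic_length \<delta>)"
      by (simp add: proj C_def)
    have "2 * ln (v n) / (geodesic_length (\<gamma> n) + C) \<le> 1" for n
      using length_bounds[of n] ln_v[of n] C by (simp add: divide_le_eq_1)
    then show "\<forall>\<^sub>F n in sequentially. projection_length (range (g n)) (range imaginary_axis) /
      (geodesic_length (\<gamma> n) + geodesic_length \<delta>) \<le> 1"
      by (simp add: proj C_def)
  qed
  moreover have "line_above quaternion_group (\<gamma> n) (range (g n))"
    "line_above quaternion_group \<delta> (range imaginary_axis)" for n
    unfolding \<gamma>_def \<delta>_def using line_above_range g_line unit_speed_geodesic_imaginary_axis by blast+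
  ultimately show ?thesis
    using surface_group_quaternion_group \<gamma>(1) \<delta> distinct
    by (intro exI[of _ "\<lambda>n. quaternion_group"] exI[of _ \<gamma>] exI[of _ "\<lambda>n. \<delta>"]
        exI[of _ "\<lambda>n. range (g n)"] exI[of _ "\<lambda>n. range imaginary_axis"]) simp
qed

end
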